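(* Suppose that $K$ is an isolated invariant continuum of a flow on the plane $\mathbb{R}^2$ and $\mathcal{H}(K)-K\neq\emptyset$. Then there exists a fixed point in $\mathbb{R}^{2}-K$. More generally, if $K$ is an isolated invariant continuum of a flow on $\mathbb{R}^2$ and a component $U$ of $\mathbb{R}^{2}-K$ contains a trajectory $\gamma$ such that $\omega(\gamma)\cap K\neq\emptyset$ and $\omega^*(\gamma)\cap K\neq\emptyset$, then there exists a fixed point in $U$.
   Context: A flow on $M=\mathbb{R}^2$ is a continuous action $\varphi:M\times\mathbb{R}\to M$; write $xt=\varphi(x,t)$. The trajectory of $x$ is $\gamma(x)=\{xt\mid t\in\mathbb{R}\}$; $\omega(x)=\bigcap_{t>0}\overline{x[t,\infty)}$, $\omega^*(x)=\bigcap_{t<0}\overline{x(-\infty,t]}$, and for a trajectory $\gamma=\gamma(x)$ put $\omega(\gamma)=\omega(x)$, $\omega^*(\gamma)=\omega^*(x)$. A continuum is a compact connected set. An isolated invariant set is a non-empty compact invariant set $K$ having an isolating neighborhood, i.e. a compact neighborhood $N$ such that $K$ is the maximal invariant set in $N$. $\mathcal{H}(K)=\mathcal{A}(K)\cap\mathcal{R}(K)$, where $\mathcal{A}(K)=\{x\mid\emptyset\neq\omega(x)\subset K\}$ and $\mathcal{R}(K)=\{x\mid\emptyset\neq\omega^*(x)\subset K\}$. *)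

theory Defs
  imports "HOL-Analysis.Analysis"
begin

text \<open>The value \<open>\<phi> x t\<close> of a flow is the point written $xt$. Limit sets of a trajectory are
  indexed by a point of it; they do not depend on the choice of that point.\<close>

definition is_flow :: "('a::topological_space \<Rightarrow> real \<Rightarrow> 'a) \<Rightarrow> bool" where
  "is_flow \<phi> \<longleftrightarrow>
     continuous_on UNIV (\<lambda>(x, t). \<phi> x t) \<and>
     (\<forall>x. \<phi> x 0 = x) \<and>
     (\<forall>x s t. \<phi> (\<phi> x s) t = \<phi> x (s + t))"

definition trajectory :: "('a \<Rightarrow> real \<Rightarrow> 'a) \<Rightarrow> 'a \<Rightarrow> 'a set" where
  "trajectory \<phi> x = range (\<phi> x)"

definition omega_limit :: "('a::topological_space \<Rightarrow> real \<Rightarrow> 'a) \<Rightarrow> 'a \<Rightarrow> 'a set" where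
  "omega_limit \<phi> x = (\<Inter>t\<in>{0<..}. closure (\<phi> x ` {t..}))"

definition omega_star_limit :: "('a::topological_space \<Rightarrow> real \<Rightarrow> 'a) \<Rightarrow> 'a \<Rightarrow> 'a set" where
  "omega_star_limit \<phi> x = (\<Inter>t\<in>{..<0}. closure (\<phi> x ` {..t}))"

definition invariant_set :: "('a \<Rightarrow> real \<Rightarrow> 'a) \<Rightarrow> 'a set \<Rightarrow> bool" where
  "invariant_set \<phi> S \<longleftrightarrow> (\<forall>x\<in>S. trajectory \<phi> x \<subseteq> S)"

definition isolating_neighborhood ::
    "('a::topological_space \<Rightarrow> real \<Rightarrow> 'a) \<Rightarrow> 'a set \<Rightarrow> 'a set \<Rightarrow> bool" where
  "isolating_neighborhood \<phi> K N \<longleftrightarrow>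
     compact N \<and> K \<subseteq> interior N \<and>
     invariant_set \<phi> K \<and> (\<forall>S. invariant_set \<phi> S \<and> S \<subseteq> N \<longrightarrow> S \<subseteq> K)"

definition isolated_invariant_set ::
    "('a::topological_space \<Rightarrow> real \<Rightarrow> 'a) \<Rightarrow> 'a set \<Rightarrow> bool" where
  "isolated_invariant_set \<phi> K \<longleftrightarrow>
     K \<noteq> {} \<and> compact K \<and> invariant_set \<phi> K \<and> (\<exists>N. isolating_neighborhood \<phi> K N)"

definition attraction_set :: "('a::topological_space \<Rightarrow> real \<Rightarrow> 'a) \<Rightarrow> 'a set \<Rightarrow> 'a set" where
  "attraction_set \<phi> K = {x. omega_limit \<phi> x \<noteq> {} \<and> omega_limit \<phi> x \<subseteq> K}"

definition repulsion_set :: "('a::topological_space \<Rightarrow> real \<Rightarrow> 'a) \<Rightarrow> 'a set \<Rightarrow> 'a set" where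
  "repulsion_set \<phi> K = {x. omega_star_limit \<phi> x \<noteq> {} \<and> omega_star_limit \<phi> x \<subseteq> K}"

definition homoclinic_set :: "('a::topological_space \<Rightarrow> real \<Rightarrow> 'a) \<Rightarrow> 'a set \<Rightarrow> 'a set" where
  "homoclinic_set \<phi> K = attraction_set \<phi> K \<inter> repulsion_set \<phi> K"

definition fixed_point :: "('a \<Rightarrow> real \<Rightarrow> 'a) \<Rightarrow> 'a \<Rightarrow> bool" where
  "fixed_point \<phi> p \<longleftrightarrow> (\<forall>t. \<phi> p t = p)"

definition continuum :: "'a::topological_space set \<Rightarrow> bool" where
  "continuum K \<longleftrightarrow> compact K \<and> connected K"

end

theory Submission
  imports Defs "HOL-Complex_Analysis.Riemann_Mapping"
begin

text \<open>
  The plane is treated as \<open>\<complex>\<close>. Let \<open>U\<close> be a component of the complement of \<open>K\<close>, and suppose that \<open>U\<close>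
  contains no fixed point but does contain an orbit whose two limit sets both meet \<open>K\<close>. A
  contradiction arises from the isolation of \<open>K\<close>: there are orbits in \<open>U\<close> that stay arbitrarily close
  to \<open>K\<close> for all time. Three facts lead to them.

  \<^item> \<^emph>\<open>An orbit whose two limit sets meet \<open>K\<close> has no limit point in \<open>U\<close>\<close>
  (\<open>omega_limit_point_off_continuum_fixed\<close>). At a limit point \<open>y\<close> in \<open>U\<close> there would be a transversal;
  a piece of the orbit between two returns to it, closed up by an arc of the transversal, is a Jordan
  curve that the orbit crosses only along that arc and always in the same direction. Hence past and
  future of the orbit lie on different sides of the curve. Both accumulate on \<open>K\<close>, which is connected
  and misses the curve: impossible. So such an orbit is homoclinic to \<open>K\<close> in the strong sense that
  both its ends converge to \<open>K\<close>. It then separates \<open>U\<close> (\<open>separates_component\<close>): the map to the circle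
  that is constant on \<open>K\<close> and runs once around the circle along the orbit has no continuous
  logarithm, and the theorem of Borsuk applies.

  \<^item> \<^emph>\<open>In a simply connected region without fixed points no orbit has a limit point\<close>
  (\<open>no_recurrence_in_simply_connected\<close>). The argument follows the direction of the secants
  \<open>x\<^sub>v - x\<^sub>u\<close> with \<open>u < v\<close> along an orbit piece \<open>x\<^sub>a, \<dots>, x\<^sub>b\<close> whose end points nearly coincide.
  For a closed orbit the idea is this: the secant over time \<open>s\<close> has a globally defined angle, because the
  region is simply connected. For a period \<open>T\<close> the secants from \<open>x\<close> to \<open>xs\<close> and from \<open>xs\<close> to
  \<open>xT = x\<close> are opposite, so that their angles differ by a constant odd multiple of \<open>\<pi>\<close>. Exchanging the
  roles of the two points changes the sign of this difference, so it would have to be zero. The same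
  bookkeeping, with small errors, works for an orbit piece that almost closes up. It takes the place
  of the usual index computation for Jordan curves.

  \<^item> \<^emph>\<open>Homoclinic lines are nested\<close> (\<open>arbitrarily_small_line\<close>). The given orbit and \<open>K\<close> bound a simply
  connected bounded region \<open>V\<close> in \<open>U\<close>. By the second fact the limit sets of an orbit in \<open>V\<close> lie on
  the boundary of \<open>V\<close> and hence meet \<open>K\<close>, so by the first fact every orbit in \<open>V\<close> is homoclinic and
  cuts off a piece of \<open>V\<close>. If all of them left a fixed neighborhood of \<open>K\<close>, compactness would give
  lower bounds for chains of such pieces and thus a minimal one; but a piece contains orbits, and
  these cut off smaller pieces.
\<close>

section \<open>Flows on the plane and their limit sets\<close>

locale plane_flow =
  fixes \<phi> :: "complex \<Rightarrow> real \<Rightarrow> complex"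
  assumes flow: "is_flow \<phi>"
begin

lemma zero [simp]: "\<phi> x 0 = x"
  and add: "\<phi> (\<phi> x s) t = \<phi> x (s + t)"
  using flow by (auto simp: is_flow_def)

lemma minus [simp]: "\<phi> (\<phi> x s) (- s) = x" "\<phi> (\<phi> x (- s)) s = x"
  by (simp_all add: add)

lemma continuous [continuous_intros]:
  assumes "continuous_on A f" "continuous_on A g"
  shows "continuous_on A (\<lambda>z. \<phi> (f z) (g z))"
proof -
  have "continuous_on UNIV (\<lambda>(x, t). \<phi> x t)"
    using flow by (simp add: is_flow_def)
  from continuous_on_compose2[OF this continuous_on_Pair[OF assms]] show ?thesis
    by simp
qed

lemma tendsto [tendsto_intros]:
  assumes "(f \<longlongrightarrow> l) F" "(g \<longlongrightarrow> m) F"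
  shows "((\<lambda>z. \<phi> (f z) (g z)) \<longlongrightarrow> \<phi> l m) F"
proof -
  have "continuous_on UNIV (\<lambda>p. \<phi> (fst p) (snd p))"
    by (intro continuous_intros)
  then have "isCont (\<lambda>p. \<phi> (fst p) (snd p)) (l, m)"
    by (simp add: continuous_on_eq_continuous_at)
  from isCont_tendsto_compose[OF this tendsto_Pair[OF assms]] show ?thesis
    by simp
qed

lemma reverse: "plane_flow (\<lambda>x t. \<phi> x (- t))"
proof -
  have "continuous_on UNIV (\<lambda>p. \<phi> (fst p) (- snd p))"
    by (intro continuous_intros)
  then show ?thesis
    by (unfold_locales) (simp add: is_flow_def add case_prod_unfold)
qed

lemma inj_iff: "\<phi> x s = \<phi> x t \<longleftrightarrow> \<phi> x (t - s) = x"
proof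
  assume "\<phi> x s = \<phi> x t"
  then have "\<phi> (\<phi> x s) (- s) = \<phi> (\<phi> x t) (- s)" by simp
  then show "\<phi> x (t - s) = x" by (simp add: add)
next
  assume "\<phi> x (t - s) = x"
  then have "\<phi> (\<phi> x (t - s)) s = \<phi> x s" by simp
  then show "\<phi> x s = \<phi> x t" by (simp add: add)
qed

lemma period_multiple:
  assumes "\<phi> x s = x" shows "\<phi> x (of_int k * s) = x"
proof -
  have nat: "\<phi> x (of_nat n * s) = x" for n
  proof (induction n)
    case (Suc n)
    have "\<phi> x (of_nat (Suc n) * s) = \<phi> (\<phi> x (of_nat n * s)) s"
      by (simp add: add algebra_simps)
    with Suc assms show ?case by simp
  qed simp
  show ?thesis
  proof (cases "k \<ge> 0")
    case True
    with nat[of "nat k"] show ?thesis by simp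
  next
    case False
    with nat[of "nat (- k)"] have "\<phi> x (- (of_int k * s)) = x" by simp
    with minus(2)[of x "of_int k * s"] show ?thesis by simp
  qed
qed

lemma connected_orbit: "connected (\<phi> x ` T)" if "connected T"
  by (intro connected_continuous_image continuous_intros that)

lemma compact_orbit: "compact (\<phi> x ` T)" if "compact T"
  by (intro compact_continuous_image continuous_intros that)

lemma omega_limit_iff:
  "y \<in> omega_limit \<phi> x \<longleftrightarrow> (\<forall>e>0. \<forall>T. \<exists>t\<ge>T. dist (\<phi> x t) y < e)"
proof
  assume y: "y \<in> omega_limit \<phi> x"
  show "\<forall>e>0. \<forall>T. \<exists>t\<ge>T. dist (\<phi> x t) y < e"
  proof (intro allI impI)
    fix e T :: real assume "e > 0"
    have "y \<in> closure (\<phi> x ` {max 1 T..})"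
      using y by (auto simp: omega_limit_def)
    then obtain t where "t \<ge> max 1 T" "dist (\<phi> x t) y < e"
      using \<open>e > 0\<close> by (auto simp: closure_approachable)
    then show "\<exists>t\<ge>T. dist (\<phi> x t) y < e" by auto
  qed
next
  assume "\<forall>e>0. \<forall>T. \<exists>t\<ge>T. dist (\<phi> x t) y < e"
  then show "y \<in> omega_limit \<phi> x"
    by (force simp: omega_limit_def closure_approachable)
qed

lemma omega_star_limit_eq: "omega_star_limit \<phi> x = omega_limit (\<lambda>x t. \<phi> x (- t)) x"
proof -
  have img: "(\<lambda>t. \<phi> x (- t)) ` {t..} = \<phi> x ` {..- t}" for t
  proof -
    have "{..- t} = uminus ` {t..}" by simp
    then show ?thesis by (simp only: image_image)
  qed
  have "(\<Inter>t\<in>{..<0}. closure (\<phi> x ` {..t})) = (\<Inter>t\<in>uminus ` {0<..}. closure (\<phi> x ` {..t}))"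
    by simp
  then show ?thesis
    unfolding omega_star_limit_def omega_limit_def img by (simp only: image_image)
qed

lemma omega_limit_reverse: "omega_limit \<phi> x = omega_star_limit (\<lambda>x t. \<phi> x (- t)) x"
  using plane_flow.omega_star_limit_eq[OF reverse] by simp

lemma closed_omega_limit: "closed (omega_limit \<phi> x)"
  unfolding omega_limit_def by auto

lemma omega_limit_orbit: "omega_limit \<phi> (\<phi> x s) = omega_limit \<phi> x"
proof -
  have "omega_limit \<phi> x \<subseteq> omega_limit \<phi> (\<phi> x s)" for x s
  proof
    fix y assume y: "y \<in> omega_limit \<phi> x"
    show "y \<in> omega_limit \<phi> (\<phi> x s)"
      unfolding omega_limit_iff
    proof (intro allI impI)
      fix e T :: real assume "e > 0"
      then obtain t where "t \<ge> T + s" "dist (\<phi> x t) y < e"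
        using y by (auto simp: omega_limit_iff)
      then show "\<exists>t\<ge>T. dist (\<phi> (\<phi> x s) t) y < e"
        by (intro exI[of _ "t - s"]) (auto simp: add)
    qed
  qed
  from this[of x s] this[of "\<phi> x s" "- s"] show ?thesis by auto
qed

lemma omega_limit_invariant:
  assumes "y \<in> omega_limit \<phi> x" shows "\<phi> y t \<in> omega_limit \<phi> x"
  unfolding omega_limit_iff
proof (intro allI impI)
  fix e T :: real assume "e > 0"
  have "isCont (\<lambda>z. \<phi> z t) y"
    by (intro continuous_on_interior[of UNIV] continuous_intros) simp
  then obtain d where d: "d > 0" "\<And>z. dist z y < d \<Longrightarrow> dist (\<phi> z t) (\<phi> y t) < e"
    using \<open>e > 0\<close> by (auto simp: continuous_at_eps_delta)
  obtain s where "s \<ge> T - t" "dist (\<phi> x s) y < d"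
    using assms d(1) by (auto simp: omega_limit_iff)
  then show "\<exists>s\<ge>T. dist (\<phi> x s) (\<phi> y t) < e"
    by (intro exI[of _ "s + t"]) (use d(2)[of "\<phi> x s"] in \<open>auto simp: add\<close>)
qed

lemma omega_limit_of_limit:
  assumes "y \<in> omega_limit \<phi> x" shows "omega_limit \<phi> y \<subseteq> omega_limit \<phi> x"
proof
  fix z assume z: "z \<in> omega_limit \<phi> y"
  have "z \<in> closure (omega_limit \<phi> x)"
    unfolding closure_approachable
    using z omega_limit_invariant[OF assms] by (metis omega_limit_iff)
  then show "z \<in> omega_limit \<phi> x"
    by (simp add: closed_omega_limit)
qed

lemma omega_limit_subset_closed:
  assumes "closed C" "\<And>t. t \<ge> T \<Longrightarrow> \<phi> x t \<in> C"
  shows "omega_limit \<phi> x \<subseteq> C"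
proof
  fix y assume y: "y \<in> omega_limit \<phi> x"
  have "y \<in> closure C"
    unfolding closure_approachable
  proof (intro allI impI)
    fix e :: real assume "e > 0"
    then obtain t where "t \<ge> T" "dist (\<phi> x t) y < e" using y by (auto simp: omega_limit_iff)
    then show "\<exists>z\<in>C. dist z y < e" using assms(2) by blast
  qed
  then show "y \<in> C" using assms(1) by simp
qed

text \<open>Points with periods tending to zero accumulate at a fixed point: by rounding, every time is a limit of
  multiples of these periods.\<close>
lemma no_short_period:
  assumes "compact H" "\<And>z. z \<in> H \<Longrightarrow> \<not> fixed_point \<phi> z"
  obtains \<epsilon> where "\<epsilon> > 0" "\<And>z s. z \<in> H \<Longrightarrow> 0 < s \<Longrightarrow> s \<le> \<epsilon> \<Longrightarrow> \<phi> z s \<noteq> z"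
proof -
  have "\<exists>\<epsilon>>0. \<forall>z\<in>H. \<forall>s\<in>{0<..\<epsilon>}. \<phi> z s \<noteq> z"
  proof (rule ccontr)
    assume "\<not> ?thesis"
    then have "\<forall>n::nat. \<exists>z s. z \<in> H \<and> 0 < s \<and> s \<le> inverse (real (Suc n)) \<and> \<phi> z s = z"
      by (meson greaterThanAtMost_iff inverse_positive_iff_positive of_nat_0_less_iff zero_less_Suc)
    then obtain z s where zs: "\<And>n. z n \<in> H" "\<And>n. 0 < s n" "\<And>n. s n \<le> inverse (real (Suc n))"
        "\<And>n. \<phi> (z n) (s n) = z n"
      by metis
    have "s \<longlonglongrightarrow> 0"
      by (rule tendsto_sandwich[OF _ _ tendsto_const LIMSEQ_inverse_real_of_nat])
         (use zs in \<open>auto intro: always_eventually less_imp_le\<close>)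
    obtain w r where w: "w \<in> H" "strict_mono (r :: nat \<Rightarrow> nat)" "(z \<circ> r) \<longlonglongrightarrow> w"
      using \<open>compact H\<close> zs(1) unfolding compact_def by metis
    have s0: "(\<lambda>n. s (r n)) \<longlonglongrightarrow> 0"
      using LIMSEQ_subseq_LIMSEQ[OF \<open>s \<longlonglongrightarrow> 0\<close> w(2)] by (simp add: o_def)
    have "\<phi> w t = w" for t
    proof -
      define q where "q n = of_int \<lfloor>t / s (r n)\<rfloor> * s (r n)" for n
      have "\<bar>q n - t\<bar> \<le> s (r n)" for n
      proof -
        have "s (r n) > 0" by (rule zs)
        moreover have "of_int \<lfloor>t / s (r n)\<rfloor> \<le> t / s (r n)" "t / s (r n) \<le> of_int \<lfloor>t / s (r n)\<rfloor> + 1"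
          by linarith+
        ultimately have "q n \<le> t / s (r n) * s (r n)"
          "t / s (r n) * s (r n) \<le> (of_int \<lfloor>t / s (r n)\<rfloor> + 1) * s (r n)"
          unfolding q_def by (intro mult_right_mono; simp)+
        with \<open>s (r n) > 0\<close> have "q n \<le> t" "t \<le> q n + s (r n)"
          by (auto simp: q_def distrib_right)
        then show ?thesis by linarith
      qed
      then have "(\<lambda>n. q n - t) \<longlonglongrightarrow> 0"
        by (intro Lim_null_comparison[OF _ s0]) (auto intro: always_eventually)
      then have "q \<longlonglongrightarrow> t" by (simp add: LIM_zero_iff)
      then have "(\<lambda>n. \<phi> ((z \<circ> r) n) (q n)) \<longlonglongrightarrow> \<phi> w t"
        by (intro tendsto_intros w)
      moreover have "\<phi> ((z \<circ> r) n) (q n) = (z \<circ> r) n" for n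
        unfolding q_def using period_multiple[OF zs(4)] by simp
      ultimately have "(z \<circ> r) \<longlonglongrightarrow> \<phi> w t" by (simp add: o_def)
      with w(3) show ?thesis by (rule LIMSEQ_unique[symmetric])
    qed
    then show False using assms(2)[OF w(1)] by (simp add: fixed_point_def)
  qed
  then show ?thesis using that by auto
qed

lemma uniform_near:
  assumes "e > 0"
  obtains r where "r > 0" "\<And>z s. dist z y < r \<Longrightarrow> \<bar>s\<bar> \<le> T \<Longrightarrow> dist (\<phi> z s) (\<phi> y s) < e"
proof -
  have "uniformly_continuous_on (cball y 1 \<times> {-T..T}) (\<lambda>p. \<phi> (fst p) (snd p))"
    by (intro compact_uniformly_continuous continuous_intros compact_Times) auto
  then obtain d where d: "d > 0" "\<And>p q. p \<in> cball y 1 \<times> {-T..T} \<Longrightarrow> q \<in> cball y 1 \<times> {-T..T} \<Longrightarrow>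
       dist p q < d \<Longrightarrow> dist (\<phi> (fst p) (snd p)) (\<phi> (fst q) (snd q)) < e"
    using assms unfolding uniformly_continuous_on_def by metis
  show ?thesis
  proof (rule that[of "min d 1"])
    fix z s assume "dist z y < min d 1" "\<bar>s\<bar> \<le> T"
    then show "dist (\<phi> z s) (\<phi> y s) < e"
      using d(2)[of "(z, s)" "(y, s)"] by (auto simp: dist_Pair_Pair dist_commute abs_le_iff)
  qed (use d in auto)
qed

lemma omega_limit_meets_open:
  assumes "y \<in> omega_limit \<phi> x" "open A" "y \<in> A" obtains t where "t > T" "\<phi> x t \<in> A"
proof -
  obtain e where e: "e > 0" "ball y e \<subseteq> A" using assms(2,3) open_contains_ball by blast
  obtain t where "t \<ge> T + 1" "dist (\<phi> x t) y < e" using assms(1) e(1) unfolding omega_limit_iff by blast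
  then show ?thesis using that[of t] e(2) by (auto simp: dist_commute subset_iff)
qed

lemma omega_star_limit_meets_open:
  assumes "y \<in> omega_star_limit \<phi> x" "open A" "y \<in> A" obtains t where "t < T" "\<phi> x t \<in> A"
proof -
  obtain t where "t > - T" "\<phi> x (- t) \<in> A"
    using plane_flow.omega_limit_meets_open[OF reverse] assms unfolding omega_star_limit_eq by metis
  then show ?thesis using that[of "- t"] by simp
qed

lemma omega_limit_meets_compact:
  assumes "compact C" "\<And>T. \<exists>t\<ge>T. \<phi> x t \<in> C"
  shows "omega_limit \<phi> x \<inter> C \<noteq> {}"
proof -
  have "\<forall>n::nat. \<exists>t. t \<ge> real n \<and> \<phi> x t \<in> C" using assms(2) by blast
  then obtain u where u: "\<And>n::nat. u n \<ge> real n" "\<And>n. \<phi> x (u n) \<in> C" by metis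
  then obtain y r where r: "y \<in> C" "strict_mono (r :: nat \<Rightarrow> nat)" 
    and lim: "((\<lambda>n. \<phi> x (u n)) \<circ> r) \<longlonglongrightarrow> y"
    using \<open>compact C\<close> unfolding compact_def by meson
  have "y \<in> omega_limit \<phi> x"
    unfolding omega_limit_iff
  proof (intro allI impI)
    fix e S :: real assume "e > 0"
    with lim have ev: "\<forall>\<^sub>F n in sequentially. dist (\<phi> x (u (r n))) y < e"
      by (auto dest: tendstoD)
    obtain m where m: "real m \<ge> S" using real_arch_simple by blast
    from ev eventually_ge_at_top[of m] have "\<forall>\<^sub>F n in sequentially. dist (\<phi> x (u (r n))) y < e \<and> n \<ge> m"
      by eventually_elim auto
    then obtain n where n: "dist (\<phi> x (u (r n))) y < e" "n \<ge> m"
      by (auto simp: eventually_sequentially)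
    then have "u (r n) \<ge> S" using m seq_suble[OF r(2), of n] u(1)[of "r n"] by linarith
    with n show "\<exists>t\<ge>S. dist (\<phi> x t) y < e" by blast
  qed
  then show ?thesis using r(1) by blast
qed

text \<open>An orbit that left a bounded neighborhood of \<open>K\<close> again and again would cross the compact frontier of
  this neighborhood at arbitrarily late times and have a limit point there.\<close>
lemma eventually_near_omega_limit:
  assumes "compact K" "omega_limit \<phi> x \<subseteq> K" "omega_limit \<phi> x \<noteq> {}" "open A" "K \<subseteq> A"
  obtains T where "\<And>t. t \<ge> T \<Longrightarrow> \<phi> x t \<in> A"
proof -
  obtain R where R: "K \<subseteq> ball 0 R"
    using \<open>compact K\<close> compact_imp_bounded bounded_subset_ballD by blast
  define A1 where "A1 = A \<inter> ball 0 R"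
  have A1: "open A1" "K \<subseteq> A1" "A1 \<subseteq> A" "bounded A1"
    using assms R by (auto simp: A1_def bounded_Int)
  have cpt: "compact (frontier A1)" using A1(4) by (rule compact_frontier_bounded)
  have avoid: "omega_limit \<phi> x \<inter> frontier A1 = {}"
    using A1(1,2) assms(2) by (auto simp: frontier_def interior_open)
  have "\<exists>T. \<forall>t\<ge>T. \<phi> x t \<notin> frontier A1"
  proof (rule ccontr)
    assume "\<not> ?thesis"
    then have "omega_limit \<phi> x \<inter> frontier A1 \<noteq> {}"
      by (intro omega_limit_meets_compact cpt) blast
    with avoid show False by simp
  qed
  then obtain T where T: "\<And>t. t \<ge> T \<Longrightarrow> \<phi> x t \<notin> frontier A1" by blast
  obtain k where "k \<in> omega_limit \<phi> x" using assms(3) by blast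
  then obtain t where "t > T" "\<phi> x t \<in> A1"
    using omega_limit_meets_open[of k x A1] A1(1,2) assms(2) by blast
  then have "\<phi> x ` {T..} \<inter> A1 \<noteq> {}" by (auto intro: less_imp_le)
  moreover have "\<phi> x ` {T..} \<inter> frontier A1 = {}" using T by auto
  ultimately have "\<phi> x ` {T..} - A1 = {}"
    using connected_Int_frontier[OF connected_orbit[of "{T..}" x]] by auto
  then show ?thesis using that[of T] A1(3) by fastforce
qed

text \<open>A periodic orbit is compact, so it contains its limit set and cannot accumulate on \<open>K\<close>.\<close>
lemma orbit_injective:
  assumes "\<And>t. \<phi> x t \<notin> K" "omega_limit \<phi> x \<inter> K \<noteq> {}" "\<phi> x s = \<phi> x t"
  shows "s = t"
proof (rule ccontr)
  assume "s \<noteq> t"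
  define p where "p = \<bar>t - s\<bar>"
  have p: "p > 0" using \<open>s \<noteq> t\<close> by (simp add: p_def)
  have "\<phi> x p = x"
    using assms(3) inj_iff[of x s t] inj_iff[of x t s] by (auto simp: p_def abs_if)
  then have per: "\<phi> x (of_int k * p) = x" for k by (rule period_multiple)
  have "\<phi> x u \<in> \<phi> x ` {0..p}" for u
  proof -
    have "\<phi> x u = \<phi> x (u - of_int \<lfloor>u / p\<rfloor> * p)"
      using per[of "\<lfloor>u / p\<rfloor>"] add[of x "of_int \<lfloor>u / p\<rfloor> * p" "u - of_int \<lfloor>u / p\<rfloor> * p"] by simp
    moreover have "u - of_int \<lfloor>u / p\<rfloor> * p \<in> {0..p}"
    proof -
      have "of_int \<lfloor>u / p\<rfloor> * p \<le> (u / p) * p" "(u / p) * p \<le> (of_int \<lfloor>u / p\<rfloor> + 1) * p"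
        using p by (intro mult_right_mono; simp)+
      then show ?thesis using p by (simp add: distrib_right)
    qed
    ultimately show ?thesis by blast
  qed
  then have "omega_limit \<phi> x \<subseteq> \<phi> x ` {0..p}"
    by (intro omega_limit_subset_closed compact_imp_closed compact_orbit) auto
  then show False using assms(1,2) by auto
qed

text \<open>Orbits are connected, and an orbit that meets the invariant set \<open>G\<close> lies in it.\<close>
lemma component_of_complement_invariant:
  assumes "invariant_set \<phi> G" "V \<in> components (- G)" "z \<in> V" shows "\<phi> z t \<in> V"
proof -
  have "\<phi> z s \<notin> G" for s
  proof
    assume "\<phi> z s \<in> G"
    then have "range (\<phi> (\<phi> z s)) \<subseteq> G" using assms(1) by (auto simp: invariant_set_def trajectory_def)
    then have "\<phi> (\<phi> z s) (- s) \<in> G" by blast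
    then show False using in_components_subset[OF assms(2)] assms(3) by auto
  qed
  then have "range (\<phi> z) \<subseteq> - G" by auto
  moreover have "z \<in> range (\<phi> z)" by (metis zero rangeI)
  then have "V \<inter> range (\<phi> z) \<noteq> {}" using assms(3) by blast
  ultimately have "range (\<phi> z) \<subseteq> V"
    using components_maximal[OF assms(2) connected_orbit[OF connected_UNIV]] by blast
  then show ?thesis by blast
qed

end

section \<open>Secants of a flow in a simply connected region\<close>

text \<open>Two continuous logarithms of the same function differ by a constant. All comparisons of angles
  below are instances of this, with \<open>f\<close> a signed sum of logarithms.\<close>
lemma constant_log_on_connected:
  fixes f :: "'a::topological_space \<Rightarrow> complex"
  assumes "connected S" "continuous_on S f" "\<And>x. x \<in> S \<Longrightarrow> exp (f x) = w" "x \<in> S" "y \<in> S"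
  shows "f x = f y"
proof -
  have "\<exists>c. \<forall>x\<in>S. f x = c"
  proof (rule continuous_discrete_range_constant[OF assms(1,2), unfolded constant_on_def])
    fix t assume t: "t \<in> S"
    have "2 * pi \<le> norm (f u - f t)" if "u \<in> S" "f u \<noteq> f t" for u
    proof -
      have "exp (f u) = exp (f t)" using assms(3) t that by simp
      then obtain n :: int where n: "f u = f t + (of_int (2 * n) * of_real pi) * \<i>"
        by (auto simp: exp_eq)
      with that have "n \<noteq> 0" by auto
      then have "1 \<le> \<bar>real_of_int n\<bar>" by linarith
      with n show ?thesis by (simp add: norm_mult)
    qed
    then show "\<exists>e>0. \<forall>u. u \<in> S \<and> f u \<noteq> f t \<longrightarrow> e \<le> norm (f u - f t)"
      using pi_gt_zero by (intro exI[of _ "2 * pi"]) auto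
  qed
  then show ?thesis using assms(4,5) by auto
qed

corollary constant_log_on_interval:
  fixes f :: "real \<Rightarrow> complex"
  assumes "continuous_on {a..b} f" "a \<le> b" "\<And>t. t \<in> {a..b} \<Longrightarrow> exp (f t) = w"
  shows "f a = f b"
  by (rule constant_log_on_connected[OF _ assms(1,3)]) (use assms(2) in auto)

lemma Ln_near_one:
  assumes "norm (w - 1) < 1 / 2"
  shows "w \<notin> \<real>\<^sub>\<le>\<^sub>0" "norm (Ln w) < 1"
proof -
  have "\<bar>Re (w - 1)\<bar> < 1 / 2" using abs_Re_le_cmod[of "w - 1"] assms by linarith
  then show "w \<notin> \<real>\<^sub>\<le>\<^sub>0" by (auto simp: complex_nonpos_Reals_iff)
  show "norm (Ln w) < 1" using norm_Ln_le[of "w - 1"] assms by simp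
qed

lemma Ln_near_one_quotient:
  assumes "norm (p - q) < norm q / 2"
  shows "p / q \<notin> \<real>\<^sub>\<le>\<^sub>0" "norm (Ln (p / q)) < 1" "q \<noteq> 0" "p \<noteq> 0"
proof -
  show "q \<noteq> 0" "p \<noteq> 0" using assms by auto
  then have "p / q - 1 = (p - q) / q" by (simp add: field_simps)
  then have "norm (p / q - 1) < 1 / 2"
    using assms \<open>q \<noteq> 0\<close> by (simp add: norm_divide field_simps)
  then show "p / q \<notin> \<real>\<^sub>\<le>\<^sub>0" "norm (Ln (p / q)) < 1" by (rule Ln_near_one)+
qed

text \<open>Seen from a point off the segment, the end points of the segment enclose an angle less than \<open>\<pi>\<close>. So
  the principal logarithm of the quotient depends continuously on that point.\<close>
lemma quotient_nonpos_imp_closed_segment: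
  fixes p q z :: complex
  assumes "(q - z) / (p - z) \<in> \<real>\<^sub>\<le>\<^sub>0"
  shows "z \<in> closed_segment p q"
proof (cases "p = z")
  case False
  obtain r where r: "r \<le> 0" "(q - z) / (p - z) = of_real r"
    using assms by (auto elim: nonpos_Reals_cases)
  then have eq: "q - z = of_real r * (p - z)" using False by (simp add: field_simps)
  define u where "u = 1 / (1 - r)"
  have u: "0 \<le> u" "u \<le> 1" using r(1) by (auto simp: u_def field_simps)
  have "(1 - r) *\<^sub>R z = (- r) *\<^sub>R p + q"
    using eq by (simp add: scaleR_conv_of_real algebra_simps)
  then have "u *\<^sub>R ((1 - r) *\<^sub>R z) = u *\<^sub>R ((- r) *\<^sub>R p + q)" by simp
  moreover have "u * (1 - r) = 1" "u * (- r) = 1 - u" using r(1) by (auto simp: u_def field_simps)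
  ultimately have "z = (1 - u) *\<^sub>R p + u *\<^sub>R q" by (metis scaleR_one scaleR_right_distrib scaleR_scaleR)
  with u show ?thesis by (auto simp: closed_segment_def)
qed simp

text \<open>The secant argument for an almost closed curve. \<open>\<Lambda>\<close> measures the angle of the short secants
  (over time \<open>\<tau>\<close>); for loops in a simply connected region it returns almost to its initial value. All
  secants over times of at least \<open>\<tau>\<close> have a common logarithm \<open>M\<close> on a triangle of pairs \<open>(u, v)\<close>. On
  its horizontal side \<open>v = b\<close> and its vertical side \<open>u = a\<close> lie the secants from \<open>x u\<close> to \<open>x b\<close> and
  those from \<open>x a\<close> to \<open>x v\<close>. Since \<open>x a\<close> and \<open>x b\<close> almost coincide, these are almost opposite for
  \<open>u = v\<close>, and the difference \<open>w\<close> of their logarithms, up to a small correction, is constant. Going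
  around the triangle expresses \<open>2 * w\<close> as a sum of five small terms, although \<open>exp w = - 1\<close>.\<close>
lemma secant_rotation_contradiction:
  fixes x :: "real \<Rightarrow> complex" and a b \<tau> c :: real and \<Lambda> :: "real \<Rightarrow> complex"
  assumes x: "continuous_on {a..b + \<tau>} x" and \<tau>: "\<tau> > 0" "2 * \<tau> \<le> b - a"
    and inj: "\<And>u v. a \<le> u \<Longrightarrow> u + \<tau> \<le> v \<Longrightarrow> v \<le> b \<Longrightarrow> (u, v) \<noteq> (a, b) \<Longrightarrow> x u \<noteq> x v"
    and seg: "\<And>u. a + \<tau> \<le> u \<Longrightarrow> u \<le> b - \<tau> \<Longrightarrow> x u \<notin> closed_segment (x a) (x b)"
    and \<Lambda>: "continuous_on {a..b} \<Lambda>" "\<And>u. a \<le> u \<Longrightarrow> u \<le> b \<Longrightarrow> exp (\<Lambda> u) = x (u + \<tau>) - x u"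
    and close: "norm (\<Lambda> b - \<Lambda> a) < 1"
    and near: "\<And>s. 0 \<le> s \<Longrightarrow> s \<le> \<tau> \<Longrightarrow> norm (x (a + s) - x (b + s)) < c / 4"
    and far: "norm (x (a + \<tau>) - x a) \<ge> c"
        "\<And>s. 0 \<le> s \<Longrightarrow> s \<le> \<tau> \<Longrightarrow> norm (x (b + s) - x (b + s - \<tau>)) \<ge> c"
  shows False
proof -
  have cpos: "0 < c" using near[of 0] \<tau> norm_ge_zero[of "x (a + 0) - x (b + 0)"] by linarith
  \<comment> \<open>The triangle without its corner \<open>(a, b)\<close>, where the secant may vanish. The last inequality removes
    just this corner and keeps the set convex.\<close>
  define T where "T = {p. a \<le> fst p \<and> fst p + \<tau> \<le> snd p \<and> snd p \<le> b \<and> snd p - fst p < b - a}"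
  have "convex T"
  proof -
    have "T = {p. (1, 0) \<bullet> p \<ge> a} \<inter> {p. (- 1, 1) \<bullet> p \<ge> \<tau>} \<inter> {p. (0, 1) \<bullet> p \<le> b} \<inter> {p. (- 1, 1) \<bullet> p < b - a}"
      by (auto simp: T_def inner_prod_def)
    then show ?thesis
      by (simp add: convex_Int convex_halfspace_ge convex_halfspace_le convex_halfspace_lt)
  qed
  have x2: "continuous_on A (\<lambda>p. x (f p))" if "continuous_on A f" "f ` A \<subseteq> {a..b + \<tau>}" 
    for f :: "'b::topological_space \<Rightarrow> real" and A
    using continuous_on_compose2[OF x that] .
  have c1: "continuous_on T (\<lambda>p. x (snd p) - x (fst p))"
    by (intro continuous_intros x2) (use \<tau> in \<open>auto simp: T_def\<close>)
  have c2: "x (snd p) - x (fst p) \<noteq> 0" if "p \<in> T" for p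
  proof -
    have "(fst p, snd p) \<noteq> (a, b)" using that by (auto simp: T_def)
    then show ?thesis using inj[of "fst p" "snd p"] that by (simp add: T_def)
  qed
  have "\<exists>M. continuous_on T M \<and> (\<forall>p\<in>T. x (snd p) - x (fst p) = exp (M p))"
    by (rule continuous_logarithm_on_contractible[OF c1 convex_imp_contractible[OF \<open>convex T\<close>]])
       (use c2 in blast)+
  then obtain M where M: "continuous_on T M" "\<And>p. p \<in> T \<Longrightarrow> x (snd p) - x (fst p) = exp (M p)"
    by blast
  have M2: "continuous_on A (\<lambda>t. M (f t, g t))" 
    if "continuous_on A f" "continuous_on A g" "\<And>t. t \<in> A \<Longrightarrow> (f t, g t) \<in> T" for f g and A :: "real set"
    by (rule continuous_on_compose2[OF M(1) continuous_on_Pair[OF that(1,2)]]) (use that(3) in blast)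
  have eM: "exp (M (u, v)) = x v - x u" if "(u, v) \<in> T" for u v
    using M(2)[OF that] by simp
  have \<Lambda>2: "continuous_on A (\<lambda>t. \<Lambda> (f t))" if "continuous_on A f" "\<And>t. t \<in> A \<Longrightarrow> f t \<in> {a..b}" 
    for f and A :: "real set"
    by (rule continuous_on_compose2[OF \<Lambda>(1) that(1)]) (use that(2) in blast)

  \<comment> \<open>Hypotenuse: the secants over time \<open>\<tau>\<close>, for which \<open>\<Lambda>\<close> is another logarithm.\<close>
  have E1: "M (a, a + \<tau>) - \<Lambda> a = M (b - \<tau>, b) - \<Lambda> (b - \<tau>)"
  proof -
    have "M (a, a + \<tau>) - \<Lambda> a = M (b - \<tau>, b - \<tau> + \<tau>) - \<Lambda> (b - \<tau>)"
    proof (rule constant_log_on_interval[where w = 1])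
      show "continuous_on {a..b - \<tau>} (\<lambda>u. M (u, u + \<tau>) - \<Lambda> u)"
        by (intro continuous_intros M2 \<Lambda>2) (use \<tau> in \<open>auto simp: T_def\<close>)
      fix u assume u: "u \<in> {a..b - \<tau>}"
      then have "(u, u + \<tau>) \<in> T" using \<tau> by (auto simp: T_def)
      then have "exp (M (u, u + \<tau>)) = exp (\<Lambda> u)" using eM \<Lambda>(2)[of u] u \<tau> by simp
      then show "exp (M (u, u + \<tau>) - \<Lambda> u) = 1" by (simp add: exp_diff)
    qed (use \<tau> in auto)
    then show ?thesis by simp
  qed

  \<comment> \<open>The two other sides, compared with each other; \<open>\<alpha>\<close> is the small error coming from
    \<open>x a \<noteq> x b\<close>.\<close>
  define \<alpha> where "\<alpha> u = Ln ((x b - x u) / (x a - x u))" for u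
  define w where "w u = M (u, b) - M (a, u) - \<alpha> u" for u
  have mid: "(u, b) \<in> T" "(a, u) \<in> T" "(x b - x u) / (x a - x u) \<notin> \<real>\<^sub>\<le>\<^sub>0" "x a - x u \<noteq> 0" "x b - x u \<noteq> 0"
    if "u \<in> {a + \<tau>..b - \<tau>}" for u
  proof -
    show "(u, b) \<in> T" "(a, u) \<in> T" using that \<tau> by (auto simp: T_def)
    have "x u \<notin> closed_segment (x a) (x b)" using seg that by auto
    then show "(x b - x u) / (x a - x u) \<notin> \<real>\<^sub>\<le>\<^sub>0" "x a - x u \<noteq> 0" "x b - x u \<noteq> 0"
      using quotient_nonpos_imp_closed_segment by auto
  qed
  have quot: "B / (- A) / (B / A) = - 1" if "A \<noteq> 0" "B \<noteq> 0" for A B :: complex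
    using that by (simp add: field_simps)
  have w: "exp (w u) = - 1" if "u \<in> {a + \<tau>..b - \<tau>}" for u
  proof -
    let ?A = "x a - x u" and ?B = "x b - x u"
    have nz: "?A \<noteq> 0" "?B \<noteq> 0" using mid[OF that] by auto
    have "exp (w u) = ?B / (- ?A) / exp (\<alpha> u)"
      unfolding w_def exp_diff using mid[OF that] by (simp add: eM)
    also have "exp (\<alpha> u) = ?B / ?A"
      unfolding \<alpha>_def using nz by (intro exp_Ln) (simp add: divide_eq_0_iff)
    also have "?B / (- ?A) / (?B / ?A) = - 1"
      by (rule quot) (rule nz)+
    finally show ?thesis .
  qed
  have "continuous_on {a + \<tau>..b - \<tau>} w"
    unfolding w_def \<alpha>_def
    by (intro continuous_intros M2 x2) (use mid \<tau> in auto)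
  then have E2: "w (a + \<tau>) = w (b - \<tau>)"
    by (rule constant_log_on_interval) (use w \<tau> in auto)

  \<comment> \<open>Near the missing corner: the secant from \<open>x (a + s)\<close> to \<open>x (b + s - \<tau>)\<close> is almost opposite to the
    short secant from \<open>x (b + s - \<tau>)\<close> to \<open>x (b + s)\<close>.\<close>
  define \<rho> where "\<rho> s = Ln ((x (a + s) - x (b + s - \<tau>)) / (x (b + s) - x (b + s - \<tau>)))" for s
  have rat: "norm ((x (a + s) - x (b + s - \<tau>)) - (x (b + s) - x (b + s - \<tau>))) < norm (x (b + s) - x (b + s - \<tau>)) / 2"
    if "s \<in> {0..\<tau>}" for s
  proof -
    have "norm (x (a + s) - x (b + s)) < c / 2" using near[of s] that cpos by auto
    then show ?thesis using far(2)[of s] that by simp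
  qed
  note rat = Ln_near_one_quotient[OF rat]
  have E3: "M (a, b - \<tau>) - \<Lambda> (b - \<tau>) - \<rho> 0 = M (a + \<tau>, b) - \<Lambda> b - \<rho> \<tau>"
  proof -
    have "M (a + 0, b + 0 - \<tau>) - \<Lambda> (b + 0 - \<tau>) - \<rho> 0 = M (a + \<tau>, b + \<tau> - \<tau>) - \<Lambda> (b + \<tau> - \<tau>) - \<rho> \<tau>"
    proof (rule constant_log_on_interval[where w = "- 1"])
      have inT: "(a + s, b + s - \<tau>) \<in> T" if "s \<in> {0..\<tau>}" for s
        using that \<tau> by (auto simp: T_def)
      show "continuous_on {0..\<tau>} (\<lambda>s. M (a + s, b + s - \<tau>) - \<Lambda> (b + s - \<tau>) - \<rho> s)"
        unfolding \<rho>_def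
        by (intro continuous_on_diff continuous_on_Ln' continuous_on_divide M2 \<Lambda>2 x2 continuous_on_add
                  continuous_on_const continuous_on_id ballI inT rat) (use \<tau> in auto)
      fix s assume s: "s \<in> {0..\<tau>}"
      let ?P = "x (a + s) - x (b + s - \<tau>)" and ?Q = "x (b + s) - x (b + s - \<tau>)"
      have "exp (M (a + s, b + s - \<tau>)) = - ?P" using eM[OF inT[OF s]] by simp
      moreover have "exp (\<Lambda> (b + s - \<tau>)) = ?Q" using \<Lambda>(2)[of "b + s - \<tau>"] s \<tau> by simp
      moreover have "exp (\<rho> s) = ?P / ?Q" unfolding \<rho>_def using rat[OF s] by simp
      ultimately show "exp (M (a + s, b + s - \<tau>) - \<Lambda> (b + s - \<tau>) - \<rho> s) = - 1"
        using rat(3,4)[OF s] by (simp only: exp_diff) (simp add: divide_simps)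
    qed (use \<tau> in auto)
    then show ?thesis by simp
  qed

  have eq: "2 * w (a + \<tau>) = (\<Lambda> b - \<Lambda> a) + \<rho> \<tau> - \<rho> 0 - \<alpha> (a + \<tau>) - \<alpha> (b - \<tau>)"
  proof -
    have "M (a, a + \<tau>) = M (b - \<tau>, b) - \<Lambda> (b - \<tau>) + \<Lambda> a"
      using E1 by (simp add: diff_eq_eq)
    moreover have "M (a + \<tau>, b) = M (a, b - \<tau>) - \<Lambda> (b - \<tau>) - \<rho> 0 + \<Lambda> b + \<rho> \<tau>"
      using E3 by (simp add: diff_eq_eq)
    moreover have "2 * w (a + \<tau>) = w (a + \<tau>) + w (b - \<tau>)" using E2 by simp
    ultimately show ?thesis by (simp add: w_def)
  qed
  have s0: "0 \<in> {0..\<tau>}" "\<tau> \<in> {0..\<tau>}" using \<tau> by auto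
  have n0: "norm (x a - x b) < c / 4" using near[of 0] \<tau> by simp
  have "norm (\<alpha> (a + \<tau>)) < 1"
    unfolding \<alpha>_def
    by (rule Ln_near_one_quotient) (use n0 far(1) cpos in \<open>simp add: norm_minus_commute\<close>)
  moreover have "norm (\<alpha> (b - \<tau>)) < 1"
  proof -
    have "c \<le> norm (x b - x (b - \<tau>))" using far(2)[of 0] \<tau> by simp
    also have "\<dots> \<le> norm (x b - x a) + norm (x a - x (b - \<tau>))"
      using norm_triangle_ineq[of "x b - x a" "x a - x (b - \<tau>)"] by simp
    finally have "norm (x a - x (b - \<tau>)) > c / 2" using n0 cpos by (simp add: norm_minus_commute)
    then show ?thesis
      unfolding \<alpha>_def
      by (intro Ln_near_one_quotient) (use n0 in \<open>simp add: norm_minus_commute\<close>)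
  qed
  moreover have "norm (\<rho> 0) < 1" "norm (\<rho> \<tau>) < 1"
    unfolding \<rho>_def using rat(2)[OF s0(1)] rat(2)[OF s0(2)] by auto
  moreover have "norm (2 * w (a + \<tau>)) \<le> norm (\<Lambda> b - \<Lambda> a) + norm (\<rho> \<tau>) + norm (\<rho> 0) + norm (\<alpha> (a + \<tau>)) + norm (\<alpha> (b - \<tau>))"
    unfolding eq by (smt (verit, best) norm_triangle_ineq4 norm_triangle_ineq)
  ultimately have "norm (w (a + \<tau>)) < 3" using close by (simp add: norm_mult)
  moreover have "pi \<le> norm (w (a + \<tau>))"
  proof -
    have "exp (w (a + \<tau>)) = exp (\<i> * of_real pi)" using w[of "a + \<tau>"] \<tau> by simp
    then obtain n :: int where n: "w (a + \<tau>) = \<i> * of_real pi + of_real (of_int (2 * n) * pi) * \<i>"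
      unfolding exp_eq by blast
    have "Im (w (a + \<tau>)) = (2 * n + 1) * pi" unfolding n by (simp add: algebra_simps)
    moreover have "1 \<le> \<bar>2 * n + 1\<bar>" by presburger
    then have "1 \<le> \<bar>real_of_int (2 * n + 1)\<bar>" by linarith
    ultimately have "\<bar>Im (w (a + \<tau>))\<bar> \<ge> pi" by (simp add: abs_mult)
    then show ?thesis using abs_Im_le_cmod[of "w (a + \<tau>)"] by linarith
  qed
  ultimately show False using pi_gt3 by linarith
qed

context plane_flow
begin

text \<open>Contracting the loop inside \<open>V\<close> contracts the loop of secants inside \<open>\<complex> - {0}\<close>, provided that the
  secants are taken over a time below all periods occurring in the contraction. The secants over the
  longer time \<open>\<tau>\<close> are first deformed to these, which needs the absence of short periods on the loop
  only.\<close>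
lemma secant_logarithm_on_loop:
  assumes "simply_connected V" and nofix: "\<And>z. z \<in> V \<Longrightarrow> \<not> fixed_point \<phi> z"
    and \<beta>: "path \<beta>" "pathfinish \<beta> = pathstart \<beta>" "path_image \<beta> \<subseteq> V"
    and \<tau>: "\<tau> > 0" "\<And>z s. z \<in> path_image \<beta> \<Longrightarrow> 0 < s \<Longrightarrow> s \<le> \<tau> \<Longrightarrow> \<phi> z s \<noteq> z"
  shows "\<exists>q. continuous_on {0..1} q \<and> q 0 = q 1 \<and> (\<forall>t\<in>{0..1}. exp (q t) = \<phi> (\<beta> t) \<tau> - \<beta> t)"
proof -
  define F where "F s z = \<phi> z s - z" for s z
  have F: "continuous_on A (\<lambda>z. F (f z) (g z))" if "continuous_on A f" "continuous_on A g" 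
    for f g and A :: "'b::topological_space set"
    unfolding F_def by (intro continuous_intros that)
  define p where "p = pathstart \<beta>"
  have "p \<in> V" using \<beta> by (auto simp: p_def)
  then have "homotopic_loops V \<beta> (linepath p p)"
    using assms(1) \<beta> unfolding simply_connected_def by simp
  then obtain h where h: "continuous_on ({0..1::real} \<times> {0..1}) h" "h \<in> ({0..1} \<times> {0..1}) \<rightarrow> V"
      "\<And>x. x \<in> {0..1} \<Longrightarrow> h (0, x) = \<beta> x" "\<And>x. x \<in> {0..1} \<Longrightarrow> h (1, x) = p"
      "\<And>t. t \<in> {0..1} \<Longrightarrow> pathfinish (h \<circ> Pair t) = pathstart (h \<circ> Pair t)"
    unfolding homotopic_loops by (auto simp: linepath_refl)
  have "compact (h ` ({0..1} \<times> {0..1}))"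
    by (intro compact_continuous_image h compact_Times) auto
  moreover have "\<not> fixed_point \<phi> z" if "z \<in> h ` ({0..1} \<times> {0..1})" for z
    using h(2) nofix that by auto
  ultimately obtain \<epsilon>0 where \<epsilon>0: "\<epsilon>0 > 0" 
      "\<And>z s. z \<in> h ` ({0..1} \<times> {0..1}) \<Longrightarrow> 0 < s \<Longrightarrow> s \<le> \<epsilon>0 \<Longrightarrow> \<phi> z s \<noteq> z"
    by (rule no_short_period) auto
  define \<epsilon> where "\<epsilon> = min \<epsilon>0 \<tau>"
  have \<epsilon>: "0 < \<epsilon>" "\<epsilon> \<le> \<tau>" "\<epsilon> \<le> \<epsilon>0" using \<epsilon>0(1) \<tau>(1) by (auto simp: \<epsilon>_def)
  have "homotopic_loops (- {0}) (F \<tau> \<circ> \<beta>) (F \<epsilon> \<circ> \<beta>)"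
    unfolding homotopic_loops
  proof (intro exI conjI ballI)
    let ?H = "\<lambda>p. F ((1 - fst p) * \<tau> + fst p * \<epsilon>) (\<beta> (snd p))"
    have \<beta>2: "continuous_on ({0..1::real} \<times> {0..1}) (\<lambda>p. \<beta> (snd p))"
      by (rule continuous_on_compose2[OF \<beta>(1)[unfolded path_def]]) (auto intro!: continuous_intros)
    show "continuous_on ({0..1} \<times> {0..1}) ?H"
      by (intro F continuous_intros \<beta>2)
    have "F ((1 - r) * \<tau> + r * \<epsilon>) (\<beta> t) \<noteq> 0" if "r \<in> {0..1}" "t \<in> {0..1}" for r t
    proof -
      have "(1 - r) * \<tau> + r * \<epsilon> \<le> \<tau>"
        using \<epsilon> that by (intro convex_bound_le) auto
      moreover have "(1 - r) * \<epsilon> + r * \<epsilon> \<le> (1 - r) * \<tau> + r * \<epsilon>"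
        using \<epsilon> that by (intro add_mono mult_left_mono) auto
      then have "0 < (1 - r) * \<tau> + r * \<epsilon>" using \<epsilon>(1) by (simp add: algebra_simps)
      ultimately show ?thesis
        using \<tau>(2)[of "\<beta> t" "(1 - r) * \<tau> + r * \<epsilon>"] that by (simp add: F_def path_image_def)
    qed
    then show "?H \<in> {0..1} \<times> {0..1} \<rightarrow> - {0}" by auto
    show "pathfinish (?H \<circ> Pair t) = pathstart (?H \<circ> Pair t)" for t
      using \<beta>(2) by (simp add: pathfinish_def pathstart_def)
  qed auto
  moreover have "homotopic_loops (- {0}) (F \<epsilon> \<circ> \<beta>) (linepath (F \<epsilon> p) (F \<epsilon> p))"
    unfolding homotopic_loops
  proof (intro exI conjI ballI)
    show "continuous_on ({0..1} \<times> {0..1}) (F \<epsilon> \<circ> h)"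
      unfolding o_def by (intro F continuous_intros h)
    show "F \<epsilon> \<circ> h \<in> {0..1} \<times> {0..1} \<rightarrow> - {0}"
      using \<epsilon>0(2)[OF _ \<epsilon>(1,3)] by (auto simp: F_def)
    show "pathfinish (F \<epsilon> \<circ> h \<circ> Pair t) = pathstart (F \<epsilon> \<circ> h \<circ> Pair t)" if "t \<in> {0..1}" for t
      using h(5)[OF that] by (simp add: pathfinish_def pathstart_def)
  qed (use h in \<open>auto simp: linepath_refl\<close>)
  ultimately have hom: "homotopic_loops (- {0}) (F \<tau> \<circ> \<beta>) (linepath (F \<epsilon> p) (F \<epsilon> p))"
    by (rule homotopic_loops_trans)
  then have "winding_number (F \<tau> \<circ> \<beta>) 0 = winding_number (linepath (F \<epsilon> p) (F \<epsilon> p)) 0"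
    by (rule winding_number_homotopic_loops)
  also have "\<dots> = 0"
    using homotopic_loops_imp_subset[OF hom] by (intro winding_number_trivial) auto
  finally have wn: "winding_number (F \<tau> \<circ> \<beta>) 0 = 0" .
  have "path (F \<tau> \<circ> \<beta>)" "0 \<notin> path_image (F \<tau> \<circ> \<beta>)"
    using homotopic_loops_imp_path[OF hom] homotopic_loops_imp_subset[OF hom] by auto
  from winding_number_as_continuous_log[OF this] obtain q where 
    "path q" "pathfinish q - pathstart q = 0" "\<And>t. t \<in> {0..1} \<Longrightarrow> (F \<tau> \<circ> \<beta>) t = 0 + exp (q t)"
    using wn by auto
  then show ?thesis
    by (intro exI[of _ q]) (auto simp: path_def pathfinish_def pathstart_def F_def)
qed

text \<open>The orbit piece is chosen as a shortest one (of length at least \<open>2 * \<tau>\<close>) with both end points on a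
  small segment \<open>I\<close> near \<open>y\<close>. Minimality keeps the piece away from the segment between its end
  points, and it also excludes periods shorter than the piece.\<close>
theorem no_recurrence_in_simply_connected:
  assumes "open V" "simply_connected V" and nofix: "\<And>z. z \<in> V \<Longrightarrow> \<not> fixed_point \<phi> z"
    and xV: "\<And>t. t \<ge> 0 \<Longrightarrow> \<phi> x t \<in> V" and "y \<in> V"
  shows "y \<notin> omega_limit \<phi> x"
proof
  assume y: "y \<in> omega_limit \<phi> x"
  obtain r0 where r0: "r0 > 0" "cball y r0 \<subseteq> V"
    using \<open>open V\<close> \<open>y \<in> V\<close> open_contains_cball by blast
  obtain \<epsilon> where \<epsilon>: "\<epsilon> > 0" "\<And>z s. z \<in> cball y r0 \<Longrightarrow> 0 < s \<Longrightarrow> s \<le> \<epsilon> \<Longrightarrow> \<phi> z s \<noteq> z"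
    by (rule no_short_period[of "cball y r0"]) (use r0 nofix in auto)
  define \<tau> where "\<tau> = \<epsilon> / 2"
  have \<tau>: "\<tau> > 0" "\<And>z s. z \<in> cball y r0 \<Longrightarrow> 0 < s \<Longrightarrow> s \<le> 2 * \<tau> \<Longrightarrow> \<phi> z s \<noteq> z"
    using \<epsilon> by (auto simp: \<tau>_def)
  have ydist: "\<phi> y s \<noteq> \<phi> y (s + t)" if "0 < t" "t \<le> 2 * \<tau>" for s t
    unfolding inj_iff using \<tau>(2)[of y t] that r0(1) by simp
  obtain c1 where c1: "c1 > 0" "\<And>s. s \<in> {0..\<tau>} \<Longrightarrow> c1 \<le> dist (\<phi> y s) (\<phi> y (s - \<tau>))"
  proof -
    have "\<exists>s\<in>{0..\<tau>}. \<forall>t\<in>{0..\<tau>}. dist (\<phi> y s) (\<phi> y (s - \<tau>)) \<le> dist (\<phi> y t) (\<phi> y (t - \<tau>))"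
      by (intro continuous_attains_inf continuous_intros) (use \<tau> in auto)
    then obtain s where "\<forall>t\<in>{0..\<tau>}. dist (\<phi> y s) (\<phi> y (s - \<tau>)) \<le> dist (\<phi> y t) (\<phi> y (t - \<tau>))" by blast
    moreover have "dist (\<phi> y s) (\<phi> y (s - \<tau>)) > 0" using ydist[of \<tau> "s - \<tau>"] \<tau>(1) by auto
    ultimately show ?thesis using that by blast
  qed
  obtain c2 where c2: "c2 > 0" "\<And>s. s \<in> {\<tau>..2*\<tau>} \<Longrightarrow> c2 \<le> dist (\<phi> y s) y"
  proof -
    have "\<exists>s\<in>{\<tau>..2*\<tau>}. \<forall>t\<in>{\<tau>..2*\<tau>}. dist (\<phi> y s) y \<le> dist (\<phi> y t) y"
      by (intro continuous_attains_inf continuous_intros) (use \<tau> in auto)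
    then obtain s where "s \<in> {\<tau>..2*\<tau>}" "\<forall>t\<in>{\<tau>..2*\<tau>}. dist (\<phi> y s) y \<le> dist (\<phi> y t) y" by blast
    moreover from this(1) have "dist (\<phi> y s) y > 0" using ydist[of s 0] \<tau>(1) by auto
    ultimately show ?thesis using that by blast
  qed
  define c where "c = min c1 c2 / 2"
  have c: "c > 0" "\<And>s. s \<in> {0..\<tau>} \<Longrightarrow> 2 * c \<le> dist (\<phi> y s) (\<phi> y (s - \<tau>))" 
    "\<And>s. s \<in> {\<tau>..2*\<tau>} \<Longrightarrow> 2 * c \<le> dist (\<phi> y s) y"
  proof -
    have le: "c > 0" "2 * c \<le> c1" "2 * c \<le> c2" using c1(1) c2(1) by (auto simp: c_def)
    show "c > 0" by fact
    show "2 * c \<le> dist (\<phi> y s) (\<phi> y (s - \<tau>))" if "s \<in> {0..\<tau>}" for s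
      using c1(2)[OF that] le by linarith
    show "2 * c \<le> dist (\<phi> y s) y" if "s \<in> {\<tau>..2*\<tau>}" for s
      using c2(2)[OF that] le by linarith
  qed
  have "c / 8 > 0" using c(1) by simp
  then obtain r1 where r1: "r1 > 0" "\<And>z s. dist z y < r1 \<Longrightarrow> \<bar>s\<bar> \<le> 2 * \<tau> \<Longrightarrow> dist (\<phi> z s) (\<phi> y s) < c / 8"
    using uniform_near[OF \<open>c / 8 > 0\<close>, where T = "2 * \<tau>" and y = y] by blast
  define r where "r = min (min r0 r1) (c / 8)"
  have r: "r > 0" "r \<le> r0" "r \<le> c / 8" using r0 r1 c by (auto simp: r_def)
  define B where "B = ball y r"
  have BV: "B \<subseteq> V" using r0 r by (force simp: B_def)
  have near: "dist (\<phi> z s) (\<phi> y s) < c / 8" if "z \<in> B" "\<bar>s\<bar> \<le> 2 * \<tau>" for z s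
    using r1(2)[of z s] that by (simp add: B_def r_def dist_commute[of y])
  have far: "c \<le> dist (\<phi> z s) (\<phi> z (s - \<tau>))" if "z \<in> B" "s \<in> {0..\<tau>}" for z s
  proof -
    have "dist (\<phi> z s) (\<phi> y s) < c / 8" "dist (\<phi> z (s - \<tau>)) (\<phi> y (s - \<tau>)) < c / 8"
      by (rule near; use that \<tau>(1) in simp)+
    moreover have "dist (\<phi> y s) (\<phi> y (s - \<tau>)) \<le> 
        dist (\<phi> z s) (\<phi> y s) + dist (\<phi> z s) (\<phi> z (s - \<tau>)) + dist (\<phi> z (s - \<tau>)) (\<phi> y (s - \<tau>))"
      using dist_triangle[of "\<phi> y s" "\<phi> y (s - \<tau>)" "\<phi> z s"] dist_triangle[of "\<phi> z s" "\<phi> y (s - \<tau>)" "\<phi> z (s - \<tau>)"]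
      by (simp add: dist_commute)
    ultimately show ?thesis using c(1) c(2)[OF that(2)] by linarith
  qed
  have near2: "dist (\<phi> z s) (\<phi> z' s) < c / 4" if "z \<in> B" "z' \<in> B" "\<bar>s\<bar> \<le> 2 * \<tau>" for z z' s
    using near[of z s] near[of z' s] that dist_triangle2[of "\<phi> z s" "\<phi> z' s" "\<phi> y s"] by linarith
  \<comment> \<open>No return to \<open>B\<close> after a time between \<open>\<tau>\<close> and \<open>2 * \<tau>\<close>. This gap turns a return within a time of at
    least \<open>\<tau>\<close> into one that competes in the minimization.\<close>
  have away: "\<phi> z s \<notin> B" if "z \<in> B" "s \<in> {\<tau>..2*\<tau>}" for z s
  proof
    assume "\<phi> z s \<in> B"
    then have "dist (\<phi> z s) y < c / 8" using r(3) by (simp add: B_def dist_commute)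
    moreover have "dist (\<phi> z s) (\<phi> y s) < c / 8" using near that \<tau>(1) by auto
    ultimately have "dist (\<phi> y s) y < c"
      using dist_triangle[of "\<phi> y s" y "\<phi> z s"] c(1) by (simp add: dist_commute)
    then show False using c(3)[OF that(2)] c(1) by simp
  qed

  obtain a0 where a0: "a0 \<ge> 0" "\<phi> x a0 \<in> B"
    using y[unfolded omega_limit_iff, rule_format, OF r(1), of 0] by (auto simp: B_def dist_commute)
  obtain b0 where b0: "b0 \<ge> a0 + 2 * \<tau>" "\<phi> x b0 \<in> B"
    using y[unfolded omega_limit_iff, rule_format, OF r(1), of "a0 + 2 * \<tau>"] by (auto simp: B_def dist_commute)
  define I where "I = closed_segment (\<phi> x a0) (\<phi> x b0)"
  have "I \<subseteq> B" unfolding I_def B_def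
    using a0 b0 by (intro closed_segment_subset) (auto simp: B_def)
  define Q where "Q = {p \<in> {a0..b0} \<times> {a0..b0}. snd p - fst p \<ge> 2 * \<tau> \<and> \<phi> x (fst p) \<in> I \<and> \<phi> x (snd p) \<in> I}"
  have "compact Q"
  proof -
    have "closed {p::real\<times>real. snd p - fst p \<ge> 2 * \<tau>}"
      by (intro closed_Collect_le continuous_intros)
    moreover have "closed ((\<lambda>p::real\<times>real. \<phi> x (fst p)) -` I)" "closed ((\<lambda>p::real\<times>real. \<phi> x (snd p)) -` I)"
      by (intro closed_vimage continuous_intros; simp add: I_def)+
    moreover have "Q = {a0..b0} \<times> {a0..b0} \<inter> ({p. snd p - fst p \<ge> 2 * \<tau>} \<inter> 
        (((\<lambda>p. \<phi> x (fst p)) -` I) \<inter> ((\<lambda>p. \<phi> x (snd p)) -` I)))"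
      by (auto simp: Q_def)
    ultimately show ?thesis by (simp only:) (intro compact_Int_closed compact_Times compact_Icc closed_Int)
  qed
  moreover have "(a0, b0) \<in> Q" using b0 \<tau>(1) by (auto simp: Q_def I_def)
  ultimately have "\<exists>p\<in>Q. \<forall>q\<in>Q. snd p - fst p \<le> snd q - fst q"
    by (intro continuous_attains_inf continuous_intros) auto
  then obtain p0 where p0: "p0 \<in> Q" "\<forall>q\<in>Q. snd p0 - fst p0 \<le> snd q - fst q" by blast
  define a b where "a = fst p0" and "b = snd p0"
  have ab: "(a, b) \<in> Q" using p0(1) by (simp add: a_def b_def)
  have minimal: "b - a \<le> v - u" if "(u, v) \<in> Q" for u v
    using p0(2)[rule_format, OF that] by (simp add: a_def b_def)
  have abQ: "a0 \<le> a" "b \<le> b0" "2 * \<tau> \<le> b - a" "\<phi> x a \<in> I" "\<phi> x b \<in> I" "\<phi> x a \<in> B" "\<phi> x b \<in> B"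
    using ab \<open>I \<subseteq> B\<close> by (auto simp: Q_def)
  have segI: "closed_segment (\<phi> x a) (\<phi> x b) \<subseteq> I"
    using abQ by (intro closed_segment_subset) (auto simp: I_def)
  have noperiod: "\<phi> x (u + p) \<noteq> \<phi> x u" if "0 < p" "p < b - a" for u p
  proof
    assume "\<phi> x (u + p) = \<phi> x u"
    then have "\<phi> x p = x" using inj_iff[of x u "u + p"] by simp
    then have eq: "\<phi> x (a + p) = \<phi> x a" using inj_iff[of x a "a + p"] by simp
    have "\<phi> x a \<in> cball y r0" using abQ(6) r(2) by (auto simp: B_def)
    from \<tau>(2)[OF this that(1)] eq have "p > 2 * \<tau>" by (simp add: add not_le[symmetric]) blast
    then have "(a, a + p) \<in> Q" using abQ eq that \<tau>(1) by (auto simp: Q_def)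
    from minimal[OF this] that(2) show False by simp
  qed

  define \<beta> where "\<beta> = (\<lambda>t. \<phi> x (a + t * (b - a))) +++ linepath (\<phi> x b) (\<phi> x a)"
  have parc: "path (\<lambda>t. \<phi> x (a + t * (b - a)))"
    unfolding path_def by (intro continuous_intros)
  have join: "pathfinish (\<lambda>t. \<phi> x (a + t * (b - a))) = \<phi> x b"
    by (simp add: pathfinish_def)
  have "path \<beta>"
    unfolding \<beta>_def by (rule path_join_imp[OF parc path_linepath]) (simp add: join)
  have \<beta>im: "path_image \<beta> \<subseteq> \<phi> x ` {a..b} \<union> closed_segment (\<phi> x a) (\<phi> x b)"
  proof -
    have "a + t * (b - a) \<in> {a..b}" if "t \<in> {0..1}" for t
    proof -
      have "0 \<le> t * (b - a)" "t * (b - a) \<le> b - a"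
        using that abQ(3) \<tau>(1) by (auto intro!: mult_left_le_one_le mult_nonneg_nonneg)
      then show ?thesis unfolding atLeastAtMost_iff by linarith
    qed
    then have "path_image (\<lambda>t. \<phi> x (a + t * (b - a))) \<subseteq> \<phi> x ` {a..b}"
      unfolding path_image_def by blast
    moreover have "path_image \<beta> \<subseteq> path_image (\<lambda>t. \<phi> x (a + t * (b - a))) \<union> closed_segment (\<phi> x b) (\<phi> x a)"
      unfolding \<beta>_def path_image_linepath[symmetric] by (rule path_image_join_subset)
    ultimately show ?thesis
      unfolding closed_segment_commute[of "\<phi> x b"] by blast
  qed
  have \<beta>loop: "pathfinish \<beta> = pathstart \<beta>"
    by (simp add: \<beta>_def) (simp add: pathstart_def)
  have \<beta>V: "path_image \<beta> \<subseteq> V"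
  proof -
    have "\<phi> x ` {a..b} \<subseteq> V"
    proof
      fix z assume "z \<in> \<phi> x ` {a..b}"
      then obtain t where "t \<ge> a" "z = \<phi> x t" by auto
      then show "z \<in> V" using xV[of t] a0(1) abQ(1) by simp
    qed
    then show ?thesis using \<beta>im segI \<open>I \<subseteq> B\<close> BV by blast
  qed
  have \<beta>\<tau>: "\<phi> z s \<noteq> z" if zs: "z \<in> path_image \<beta>" "0 < s" "s \<le> \<tau>" for z s
  proof (cases "z \<in> closed_segment (\<phi> x a) (\<phi> x b)")
    case True
    then have "z \<in> B" using segI \<open>I \<subseteq> B\<close> by blast
    then have "z \<in> cball y r0" using r(2) by (auto simp: B_def)
    then show ?thesis using \<tau>(2)[of z s] zs(2,3) \<tau>(1) by simp
  next
    case False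
    then obtain u where "z = \<phi> x u" using zs(1) \<beta>im by blast
    then show ?thesis using noperiod[of s u] zs(2,3) abQ(3) \<tau>(1) by (simp add: add)
  qed
  have "\<exists>q. continuous_on {0..1} q \<and> q 0 = q 1 \<and> (\<forall>t\<in>{0..1}. exp (q t) = \<phi> (\<beta> t) \<tau> - \<beta> t)"
    by (rule secant_logarithm_on_loop[OF \<open>simply_connected V\<close> _ \<open>path \<beta>\<close> \<beta>loop \<beta>V \<tau>(1)])
       (fact nofix, fact \<beta>\<tau>)
  then obtain q where q: "continuous_on {0..1} q" "q 0 = q 1" 
    "\<And>t. t \<in> {0..1} \<Longrightarrow> exp (q t) = \<phi> (\<beta> t) \<tau> - \<beta> t"
    by blast

  define \<Lambda> where "\<Lambda> u = q ((u - a) / (b - a) / 2)" for u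
  have ba: "b - a > 0" using abQ(3) \<tau>(1) by linarith
  have range: "(u - a) / (b - a) / 2 \<in> {0..1/2}" if "u \<in> {a..b}" for u
    using that ba by (auto simp: divide_simps)
  have cont: "continuous_on {a..b + \<tau>} (\<phi> x)" by (intro continuous_intros)
  have distinct: "\<phi> x u \<noteq> \<phi> x v" if "a \<le> u" "u + \<tau> \<le> v" "v \<le> b" "(u, v) \<noteq> (a, b)" for u v
    using noperiod[of "v - u" u] that \<tau>(1) by auto
  have off_segment: "\<phi> x u \<notin> closed_segment (\<phi> x a) (\<phi> x b)" if u: "a + \<tau> \<le> u" "u \<le> b - \<tau>" for u
  proof
    assume "\<phi> x u \<in> closed_segment (\<phi> x a) (\<phi> x b)"
    then have uI: "\<phi> x u \<in> I" using segI by auto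
    show False
    proof (cases "u - a \<ge> 2 * \<tau>")
      case True
      then have "(a, u) \<in> Q" using abQ u uI \<tau>(1) by (auto simp: Q_def)
      then show False using minimal[of a u] u \<tau>(1) by simp
    next
      case False
      then have "\<phi> (\<phi> x a) (u - a) \<notin> B" using u abQ(6) by (intro away) auto
      then show False using uI \<open>I \<subseteq> B\<close> by (auto simp: add)
    qed
  qed
  have \<Lambda>cont: "continuous_on {a..b} \<Lambda>"
  proof -
    have "continuous_on {a..b} (\<lambda>u. (u - a) / (b - a) / 2)"
      using ba by (intro continuous_intros) auto
    moreover have "(\<lambda>u. (u - a) / (b - a) / 2) ` {a..b} \<subseteq> {0..1}"
    proof
      fix v assume "v \<in> (\<lambda>u. (u - a) / (b - a) / 2) ` {a..b}"
      then obtain u where u: "u \<in> {a..b}" "v = (u - a) / (b - a) / 2" by blast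
      from range[OF u(1)] have "v \<in> {0..1/2}" by (simp only: u(2))
      then show "v \<in> {0..1}" by simp
    qed
    ultimately show ?thesis
      unfolding \<Lambda>_def by (rule continuous_on_compose2[OF q(1)])
  qed
  have exp_\<Lambda>: "exp (\<Lambda> u) = \<phi> x (u + \<tau>) - \<phi> x u" if "a \<le> u" "u \<le> b" for u
  proof -
    have "2 * ((u - a) / (b - a) / 2) * (b - a) = u - a" using ba by (simp add: divide_simps) (simp add: algebra_simps)
    then have "a + 2 * ((u - a) / (b - a) / 2) * (b - a) = u" by simp
    then have "\<beta> ((u - a) / (b - a) / 2) = \<phi> x u"
      using range[of u] that by (simp only: \<beta>_def joinpaths_def) auto
    moreover have "(u - a) / (b - a) / 2 \<in> {0..1}"
      by (rule subsetD[OF _ range]) (use that in auto)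
    ultimately show ?thesis unfolding \<Lambda>_def using q(3) by (simp only: add)
  qed
  have near_ab: "norm (\<phi> x (a + s) - \<phi> x (b + s)) < c / 4" if "0 \<le> s" "s \<le> \<tau>" for s
    using near2[OF abQ(6,7), of s] that \<tau>(1) by (simp add: add dist_norm)
  have far_a: "c \<le> norm (\<phi> x (a + \<tau>) - \<phi> x a)"
    using far[OF abQ(6), of \<tau>] \<tau>(1) by (simp add: add dist_norm)
  have far_b: "c \<le> norm (\<phi> x (b + s) - \<phi> x (b + s - \<tau>))" if "0 \<le> s" "s \<le> \<tau>" for s
    using far[OF abQ(7), of s] that by (simp add: add dist_norm add_diff_eq)
  define F where "F z = \<phi> z \<tau> - z" for z
  have Fnear: "norm (F z - F (\<phi> x b)) < norm (F (\<phi> x b)) / 2" if "z \<in> B" for z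
  proof -
    have "c \<le> norm (F (\<phi> x b))" using far[OF abQ(7), of \<tau>] \<tau>(1) by (simp add: F_def dist_norm)
    moreover have "dist (\<phi> z \<tau>) (\<phi> (\<phi> x b) \<tau>) < c / 4" "dist (\<phi> z 0) (\<phi> (\<phi> x b) 0) < c / 4"
      by (rule near2[OF that abQ(7)]; use \<tau>(1) in simp)+
    moreover have "norm (F z - F (\<phi> x b)) \<le> dist (\<phi> z \<tau>) (\<phi> (\<phi> x b) \<tau>) + dist z (\<phi> x b)"
    proof -
      have "F z - F (\<phi> x b) = (\<phi> z \<tau> - \<phi> (\<phi> x b) \<tau>) - (z - \<phi> x b)" by (simp add: F_def)
      then show ?thesis unfolding dist_norm by (metis norm_triangle_ineq4)
    qed
    ultimately show ?thesis by (simp only: zero)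
  qed
  note Fq = Ln_near_one_quotient[OF Fnear]
  define h where "h t = q t - Ln (F (\<beta> t) / F (\<phi> x b))" for t
  have \<beta>2: "\<beta> t \<in> B" if "t \<in> {1/2..1}" for t
  proof -
    have "\<beta> t \<in> closed_segment (\<phi> x a) (\<phi> x b)"
    proof (cases "t = 1/2")
      case True
        have "\<beta> (1/2) = \<phi> x b" by (simp add: \<beta>_def joinpaths_def)
        then show ?thesis unfolding True by simp
    next
      case False
      then have "\<beta> t = linepath (\<phi> x b) (\<phi> x a) (2 * t - 1)" "2 * t - 1 \<in> {0..1}"
        using that by (auto simp: \<beta>_def joinpaths_def)
      then show ?thesis by (metis closed_segment_commute linepath_in_path)
    qed
    then show ?thesis using segI \<open>I \<subseteq> B\<close> by auto
  qed
  from \<open>path \<beta>\<close> have \<beta>c: "continuous_on {1/2..1} \<beta>" unfolding path_def by (rule continuous_on_subset) auto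
  have Fc: "continuous_on {1/2..1} (\<lambda>t. F (\<beta> t))" "continuous_on {1/2..1::real} (\<lambda>t. F (\<phi> x b))"
    unfolding F_def by (intro continuous_intros \<beta>c)+
  have "h (1/2) = h 1"
  proof (rule constant_log_on_interval[where w = "F (\<phi> x b)"])
    have "continuous_on {1/2..1} q" using q(1) by (rule continuous_on_subset) auto
    then show "continuous_on {1/2..1} h"
      unfolding h_def using Fq(1,3)[OF \<beta>2] Fq(3)[OF abQ(7)]
      by (intro continuous_on_diff continuous_on_Ln' continuous_on_divide Fc) auto
    fix t :: real assume t: "t \<in> {1/2..1}"
    then have "exp (q t) = F (\<beta> t)" using q(3) by (auto simp: F_def)
    then show "exp (h t) = F (\<phi> x b)" unfolding h_def using Fq[OF \<beta>2[OF t]] by (simp add: exp_diff)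
  qed auto
  moreover have "\<beta> (1/2) = \<phi> x b" "\<beta> 1 = \<phi> x a" by (auto simp: \<beta>_def joinpaths_def linepath_def)
  ultimately have "q (1/2) = q 1 - Ln (F (\<phi> x a) / F (\<phi> x b))"
    unfolding h_def using Fq(3)[OF abQ(7)] by simp
  moreover have "\<Lambda> b = q (1/2)" "\<Lambda> a = q 1" using ba q(2) by (auto simp: \<Lambda>_def)
  ultimately have \<Lambda>closes: "norm (\<Lambda> b - \<Lambda> a) < 1" using Fq(2)[OF abQ(6)] by simp
  show False
    by (rule secant_rotation_contradiction[OF cont \<tau>(1) abQ(3) distinct off_segment \<Lambda>cont exp_\<Lambda> \<Lambda>closes near_ab far_a far_b])
qed

end

section \<open>Transversals and the Jordan curves closed up by them\<close>

context plane_flow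
begin

text \<open>Existence of local cross sections for a continuous flow, after Bebutov and Whitney. The function
  \<open>g z = \<integral>\<^sub>0\<^sup>T dist (\<phi> z s) y ds\<close> has derivative \<open>dist (\<phi> z T) y - dist z y\<close> along the flow, which is
  positive near \<open>y\<close> if \<open>\<phi> y T \<noteq> y\<close>. So a level set of \<open>g\<close> is crossed exactly once by every orbit near
  \<open>y\<close>, and at a time \<open>\<tau> z\<close> that is continuous in the starting point. The map
  \<open>\<lambda>z. \<phi> z (\<tau> z)\<close> projects a ball onto a path connected piece of \<open>S\<close>.\<close>
lemma transit_time_section:
  assumes "\<not> fixed_point \<phi> y" "open O'" "y \<in> O'"
  obtains S r \<delta> \<tau> where "S \<subseteq> O'" "r > 0" "\<delta> > 0"
    "\<And>s t. s \<in> S \<Longrightarrow> \<phi> s t \<in> S \<Longrightarrow> \<bar>t\<bar> \<le> \<delta> \<Longrightarrow> t = 0"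
    "continuous_on (ball y r) \<tau>"
    "\<And>z. z \<in> ball y r \<Longrightarrow> \<phi> z (\<tau> z) \<in> S \<and> \<bar>\<tau> z\<bar> < \<delta>"
proof -
  obtain T where T: "T > 0" "\<phi> y T \<noteq> y"
  proof -
    obtain t where t: "\<phi> y t \<noteq> y" using assms(1) by (auto simp: fixed_point_def)
    then have "t \<noteq> 0" by auto
    moreover have "\<phi> y (- t) \<noteq> y" using t minus(2)[of y t] by metis
    ultimately show ?thesis using that[of t] that[of "- t"] t by linarith
  qed
  define d where "d = dist (\<phi> y T) y"
  have d: "d > 0" using T(2) by (simp add: d_def)
  have "isCont (\<phi> y) 0" "isCont (\<phi> y) T"
    by (intro continuous_on_interior[of UNIV] continuous_intros; simp)+
  then obtain \<delta>1 \<delta>2 where \<delta>1: "\<delta>1 > 0" "\<And>t. dist t 0 < \<delta>1 \<Longrightarrow> dist (\<phi> y t) (\<phi> y 0) < d / 8"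
    and \<delta>2: "\<delta>2 > 0" "\<And>t. dist t T < \<delta>2 \<Longrightarrow> dist (\<phi> y t) (\<phi> y T) < d / 8"
    using d unfolding continuous_at_eps_delta by (metis zero_less_divide_iff zero_less_numeral)
  define \<delta> where "\<delta> = min T (min \<delta>1 \<delta>2) / 4"
  have \<delta>: "\<delta> > 0" "\<delta> < \<delta>1" "\<delta> < \<delta>2" "2 * \<delta> < T"
    using \<delta>1(1) \<delta>2(1) T(1) by (auto simp: \<delta>_def)
  have d8: "d / 8 > 0" using d by simp
  obtain r1 where r1: "r1 > 0" "\<And>z s. dist z y < r1 \<Longrightarrow> \<bar>s\<bar> \<le> T + \<delta> \<Longrightarrow> dist (\<phi> z s) (\<phi> y s) < d / 8"
    using uniform_near[OF d8, where T = "T + \<delta>" and y = y] by blast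
  define k where "k z u = dist (\<phi> z u) y" for z u
  have k: "continuous_on A (\<lambda>p. k (f p) (h p))" if "continuous_on A f" "continuous_on A h" 
    for f h and A :: "'b::topological_space set"
    unfolding k_def by (intro continuous_intros that)
  have gap: "k z u + d / 4 \<le> k z (u + T)" if "z \<in> ball y r1" "\<bar>u\<bar> \<le> \<delta>" for z u
  proof -
    have "dist (\<phi> z u) (\<phi> y u) < d / 8" "dist (\<phi> z (u + T)) (\<phi> y (u + T)) < d / 8"
      by (rule r1(2); use that T(1) \<delta>(1) in \<open>simp add: dist_commute\<close>)+
    moreover have "dist (\<phi> y u) y < d / 8" "dist (\<phi> y (u + T)) (\<phi> y T) < d / 8"
      using \<delta>1(2)[of u] \<delta>2(2)[of "u + T"] that(2) \<delta> by (auto simp: dist_real_def)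
    moreover have "dist (\<phi> z u) y \<le> dist (\<phi> z u) (\<phi> y u) + dist (\<phi> y u) y" by (rule dist_triangle)
    moreover have "d \<le> dist (\<phi> y T) (\<phi> y (u + T)) + dist (\<phi> y (u + T)) (\<phi> z (u + T)) + dist (\<phi> z (u + T)) y"
      unfolding d_def using dist_triangle[of "\<phi> y T" y "\<phi> y (u + T)"] dist_triangle[of "\<phi> y (u + T)" y "\<phi> z (u + T)"] by linarith
    ultimately show ?thesis unfolding k_def using d by (simp add: dist_commute)
  qed
  define g where "g z = integral {0..T} (k z)" for z
  have "continuous_on (UNIV \<times> cbox 0 T) (\<lambda>(z, t). k z t)"
    unfolding case_prod_unfold by (intro k continuous_intros)
  from integral_continuous_on_param[OF this] have gc: "continuous_on UNIV g"
    unfolding g_def by simp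
  have gcomp: "continuous_on A (\<lambda>p. g (f p))" if "continuous_on A f" for f and A :: "'b::topological_space set"
    using continuous_on_compose2[OF gc that] by simp
  have g_shift: "g (\<phi> z t) = integral {t..t + T} (k z)" for z t
  proof -
    have "integral {0..T} (k z \<circ> (\<lambda>x. x + t)) = integral {0 + t..T + t} (k z)"
      by (intro integral_shift k continuous_intros)
    moreover have "k (\<phi> z t) = k z \<circ> (\<lambda>x. x + t)" by (auto simp: k_def add fun_eq_iff add.commute)
    ultimately show ?thesis by (simp add: g_def add.commute)
  qed
  have int: "k z integrable_on {a..b}" for z a b
    by (intro integrable_continuous_real k continuous_intros)
  have mono: "g (\<phi> z t) < g (\<phi> z t')" if z: "z \<in> ball y r1" and t: "- \<delta> \<le> t" "t < t'" "t' \<le> \<delta>" for z t t'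
  proof -
    have tT: "t' \<le> t + T" using t \<delta> by linarith
    have "integral {t..t + T} (k z) + integral {t + T..t' + T} (k z) = integral {t..t' + T} (k z)"
      using t T(1) by (intro Henstock_Kurzweil_Integration.integral_combine int) auto
    moreover have "integral {t..t'} (k z) + integral {t'..t' + T} (k z) = integral {t..t' + T} (k z)"
      using t T(1) by (intro Henstock_Kurzweil_Integration.integral_combine int) auto
    moreover have "integral {t..t'} (k z) < integral {t + T..t' + T} (k z)"
    proof -
      have "integral {t..t'} (k z) < integral {t..t'} (k z) + (t' - t) * (d / 4)" using t d by simp
      also have "\<dots> = integral {t..t'} (\<lambda>u. k z u + d / 4)"
        using t by (subst integral_add) (auto intro: int)
      also have "\<dots> \<le> integral {t..t'} (k z \<circ> (\<lambda>u. u + T))"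
        by (intro integral_le integrable_continuous_real) (use gap[OF z] t in \<open>auto simp: o_def intro!: k continuous_intros\<close>)
      also have "\<dots> = integral {t + T..t' + T} (k z)"
        by (intro integral_shift k continuous_intros)
      finally show ?thesis .
    qed
    ultimately show ?thesis unfolding g_shift by simp
  qed
  define S where "S = {z \<in> ball y r1 \<inter> O'. g z = g y}"
  have unique: "t = 0" if "s \<in> S" "\<phi> s t \<in> S" "\<bar>t\<bar> \<le> \<delta>" for s t
  proof (rule ccontr)
    assume "t \<noteq> 0"
    then consider "t < 0" | "t > 0" by linarith
    then show False
      using mono[of s t 0] mono[of s 0 t] that \<delta>(1) by cases (auto simp: S_def)
  qed
  have "open (ball y r1 \<inter> O')" using assms(2) by auto
  moreover have "y \<in> ball y r1 \<inter> O'" using r1(1) assms(3) by auto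
  ultimately obtain e where e: "e > 0" "ball y e \<subseteq> ball y r1 \<inter> O'" using open_contains_ball by blast
  have "isCont (\<phi> y) 0" by fact
  then obtain \<delta>3 where \<delta>3: "\<delta>3 > 0" "\<And>t. dist t 0 < \<delta>3 \<Longrightarrow> dist (\<phi> y t) (\<phi> y 0) < e / 2"
    using e(1) unfolding continuous_at_eps_delta by (metis half_gt_zero)
  define \<epsilon> where "\<epsilon> = min \<delta> \<delta>3 / 2"
  have \<epsilon>: "0 < \<epsilon>" "\<epsilon> < \<delta>" "\<epsilon> < \<delta>3" using \<delta>(1) \<delta>3(1) by (auto simp: \<epsilon>_def)
  have e2: "e / 2 > 0" using e(1) by simp
  obtain r2 where r2: "r2 > 0" "\<And>z s. dist z y < r2 \<Longrightarrow> \<bar>s\<bar> \<le> \<epsilon> \<Longrightarrow> dist (\<phi> z s) (\<phi> y s) < e / 2"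
    using uniform_near[OF e2, where T = \<epsilon> and y = y] by blast
  have inside: "\<phi> z s \<in> ball y r1 \<inter> O'" if "dist z y < r2" "\<bar>s\<bar> \<le> \<epsilon>" for z s
  proof -
    have "dist (\<phi> z s) (\<phi> y s) < e / 2" using r2(2) that by blast
    moreover have "dist (\<phi> y s) y < e / 2" using \<delta>3(2)[of s] that(2) \<epsilon> by (simp add: dist_real_def)
    ultimately have "dist (\<phi> z s) y < e" using dist_triangle[of "\<phi> z s" y "\<phi> y s"] by linarith
    then show ?thesis using e(2) by (auto simp: dist_commute)
  qed
  define W where "W = {z. g (\<phi> z \<epsilon>) > g y} \<inter> {z. g (\<phi> z (- \<epsilon>)) < g y} \<inter> ball y r2 \<inter> ball y r1"
  have "open W"
    unfolding W_def by (intro open_Int open_Collect_less gcomp continuous_intros open_ball)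
  moreover have "y \<in> W"
    using mono[of y 0 \<epsilon>] mono[of y "- \<epsilon>" 0] r1(1) r2(1) \<epsilon> by (auto simp: W_def)
  ultimately obtain r where r: "r > 0" "ball y r \<subseteq> W" using open_contains_ball by blast
  have "\<exists>t. \<bar>t\<bar> < \<epsilon> \<and> g (\<phi> z t) = g y" if "z \<in> W" for z
  proof -
    have "\<exists>t\<ge>- \<epsilon>. t \<le> \<epsilon> \<and> g (\<phi> z t) = g y"
      by (rule IVT') (use that \<epsilon> in \<open>auto simp: W_def intro!: gcomp continuous_intros\<close>)
    then obtain t where t: "- \<epsilon> \<le> t" "t \<le> \<epsilon>" "g (\<phi> z t) = g y" by blast
    moreover have "t \<noteq> \<epsilon>" "t \<noteq> - \<epsilon>" using that t by (auto simp: W_def)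
    ultimately show ?thesis by (intro exI[of _ t]) auto
  qed
  then obtain \<tau> where \<tau>: "\<And>z. z \<in> W \<Longrightarrow> \<bar>\<tau> z\<bar> < \<epsilon>" "\<And>z. z \<in> W \<Longrightarrow> g (\<phi> z (\<tau> z)) = g y"
    by metis
  have "continuous_on W \<tau>"
    unfolding continuous_on_iff
  proof (intro ballI allI impI)
    fix z1 e' assume z0: "z1 \<in> W" and "(e' :: real) > 0"
    define e where "e = min e' (\<epsilon> - \<bar>\<tau> z1\<bar>) / 2"
    have e: "0 < e" "e < e'" "\<bar>\<tau> z1\<bar> + e < \<epsilon>" using \<open>e' > 0\<close> \<tau>(1)[OF z0] by (auto simp: e_def min_def field_simps)
    define V where "V = {z. g (\<phi> z (\<tau> z1 + e)) > g y} \<inter> {z. g (\<phi> z (\<tau> z1 - e)) < g y}"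
    have zr: "z1 \<in> ball y r1" using z0 by (auto simp: W_def)
    have "open V" unfolding V_def by (intro open_Int open_Collect_less gcomp continuous_intros)
    moreover have "z1 \<in> V"
      using mono[OF zr, of "\<tau> z1" "\<tau> z1 + e"] mono[OF zr, of "\<tau> z1 - e" "\<tau> z1"] e \<tau>(2)[OF z0] \<epsilon>
      by (auto simp: V_def)
    ultimately obtain b where b: "b > 0" "ball z1 b \<subseteq> V" using open_contains_ball by blast
    have "dist (\<tau> z) (\<tau> z1) < e'" if z: "z \<in> W" "dist z z1 < b" for z
    proof -
      have zV: "g (\<phi> z (\<tau> z1 + e)) > g y" "g (\<phi> z (\<tau> z1 - e)) < g y"
        using b(2) z(2) by (auto simp: V_def dist_commute subset_iff)
      have zr: "z \<in> ball y r1" using z by (auto simp: W_def)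
      have "\<tau> z < \<tau> z1 + e"
      proof (rule ccontr)
        assume "\<not> \<tau> z < \<tau> z1 + e"
        then have "g (\<phi> z (\<tau> z1 + e)) \<le> g (\<phi> z (\<tau> z))"
          using mono[OF zr, of "\<tau> z1 + e" "\<tau> z"] e \<tau>(1)[OF z(1)] \<epsilon>
          by (cases "\<tau> z = \<tau> z1 + e") (auto intro: less_imp_le)
        then show False using zV \<tau>(2)[OF z(1)] by simp
      qed
      moreover have "\<tau> z > \<tau> z1 - e"
      proof (rule ccontr)
        assume "\<not> \<tau> z > \<tau> z1 - e"
        then have "g (\<phi> z (\<tau> z)) \<le> g (\<phi> z (\<tau> z1 - e))"
          using mono[OF zr, of "\<tau> z" "\<tau> z1 - e"] e \<tau>(1)[OF z(1)] \<epsilon>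
          by (cases "\<tau> z = \<tau> z1 - e") (auto intro: less_imp_le)
        then show False using zV \<tau>(2)[OF z(1)] by simp
      qed
      ultimately show ?thesis using e by (simp add: dist_real_def)
    qed
    then show "\<exists>d>0. \<forall>z\<in>W. dist z z1 < d \<longrightarrow> dist (\<tau> z) (\<tau> z1) < e'" using b(1) by blast
  qed
  then have "continuous_on (ball y r) \<tau>" using r(2) continuous_on_subset by blast
  moreover have "\<phi> z (\<tau> z) \<in> S \<and> \<bar>\<tau> z\<bar> < \<delta>" if "z \<in> ball y r" for z
  proof -
    have zW: "z \<in> W" using that r(2) by auto
    then have "dist z y < r2" by (auto simp: W_def dist_commute)
    then show ?thesis
      using inside[of z "\<tau> z"] \<tau>[OF zW] \<epsilon> by (auto simp: S_def)
  qed
  moreover have "S \<subseteq> O'" by (auto simp: S_def)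
  ultimately show ?thesis using that[of S r \<delta> \<tau>] r(1) \<delta>(1) unique by blast
qed

text \<open>After time \<open>b\<close> the orbit could return to \<open>J\<close> only through the transversal \<open>\<sigma>\<close>, and it would
  arrive there from the side \<open>B\<close>. But up to that moment it has stayed in \<open>A\<close>.\<close>
lemma leaves_transversal_loop_forever:
  assumes inj: "\<And>s t. \<phi> x s = \<phi> x t \<Longrightarrow> s = t"
    and "path \<sigma>" "pathstart \<sigma> = \<phi> x a" "pathfinish \<sigma> = \<phi> x b" 
    and \<delta>: "\<delta> > 0" "\<And>s t. s \<in> path_image \<sigma> \<Longrightarrow> \<phi> s t \<in> path_image \<sigma> \<Longrightarrow> \<bar>t\<bar> \<le> \<delta> \<Longrightarrow> t = 0"
    and "a < b" and J: "J = \<phi> x ` {a..b} \<union> path_image \<sigma>"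
    and AB: "A \<inter> B = {}" "open A" "open B" "A \<union> B = - J" "closure A \<subseteq> A \<union> J"
    and above: "\<And>p s. 0 < p \<Longrightarrow> p < 1 \<Longrightarrow> 0 < s \<Longrightarrow> s < \<delta> \<Longrightarrow> \<phi> (\<sigma> p) s \<in> A"
    and below: "\<And>p s. 0 < p \<Longrightarrow> p < 1 \<Longrightarrow> 0 < s \<Longrightarrow> s < \<delta> \<Longrightarrow> \<phi> (\<sigma> p) (- s) \<in> B"
  shows "\<phi> x ` {b<..} \<subseteq> A"
proof -
  have xb: "\<phi> x b \<in> path_image \<sigma>" using assms(4) by (metis pathfinish_in_path_image)
  have away: "t > b + \<delta>" if "t > b" "\<phi> x t \<in> path_image \<sigma>" for t
    using \<delta>(2)[OF xb, of "t - b"] that by (force simp: add)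
  have hits: "\<phi> x t \<in> path_image \<sigma>" if "t > b" "\<phi> x t \<in> J" for t
    using that inj unfolding J by force
  have first: "\<phi> x t \<in> A" if "b < t" "t < b + \<delta>" for t
  proof -
    have "continuous_on {0..1} (\<lambda>p. \<phi> (\<sigma> p) (t - b))"
      using \<open>path \<sigma>\<close> unfolding path_def by (intro continuous_intros)
    then have "(\<lambda>p. \<phi> (\<sigma> p) (t - b)) ` closure {0<..<1} \<subseteq> closure A"
      by (intro image_closure_subset) (use above that closure_subset in \<open>auto intro!: subsetD[OF closure_subset]\<close>)
    then have "\<phi> (\<sigma> 1) (t - b) \<in> closure A" by force
    moreover have "\<phi> (\<sigma> 1) (t - b) = \<phi> x t" using assms(4) by (simp add: pathfinish_def add)
    moreover have "\<phi> x t \<notin> J" using hits[OF that(1)] away[OF that(1)] that(2) by auto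
    ultimately show ?thesis using AB(5) by auto
  qed
  have never: "\<phi> x t \<notin> J" if "t > b" for t
  proof
    assume tJ: "\<phi> x t \<in> J"
    define H where "H = {u \<in> {b + \<delta>..t}. \<phi> x u \<in> path_image \<sigma>}"
    have "closed (\<phi> x -` path_image \<sigma>)"
      by (intro closed_vimage continuous_intros closed_path_image \<open>path \<sigma>\<close>)
    moreover have "H = {b + \<delta>..t} \<inter> (\<phi> x -` path_image \<sigma>)" by (auto simp: H_def)
    ultimately have "compact H" by (simp add: compact_Int_closed)
    moreover have "t \<in> H" using hits[OF that tJ] away[OF that] by (auto simp: H_def)
    ultimately obtain u where u: "u \<in> H" "\<And>v. v \<in> H \<Longrightarrow> u \<le> v" 
      using compact_attains_inf[of H] by blast
    have ub: "u > b" using u(1) \<delta>(1) by (auto simp: H_def)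
    have "\<phi> x v \<notin> J" if "v \<in> {b<..<u}" for v
    proof
      assume "\<phi> x v \<in> J"
      then have "\<phi> x v \<in> path_image \<sigma>" "v > b + \<delta>" using hits away that by auto
      then have "v \<in> H" using that u(1) by (auto simp: H_def)
      then show False using u(2)[of v] that by auto
    qed
    then have "\<phi> x ` {b<..<u} \<subseteq> A \<union> B" using AB(4) by blast
    moreover have "\<phi> x (min (b + \<delta> / 2) ((b + u) / 2)) \<in> A" 
      by (rule first) (use \<delta>(1) ub in \<open>auto simp: min_def\<close>)
    then have "A \<inter> \<phi> x ` {b<..<u} \<noteq> {}" using \<delta>(1) ub by (auto simp: min_def split: if_splits)
    ultimately have disj: "B \<inter> \<phi> x ` {b<..<u} = {}"
      using connectedD[OF connected_orbit[of "{b<..<u}" x] AB(2,3)] AB(1) by auto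
    define s where "s = min (\<delta> / 2) ((u - b) / 2)"
    have s: "0 < s" "s < \<delta>" "u - s \<in> {b<..<u}" using \<delta>(1) ub by (auto simp: s_def min_def field_simps)
    obtain p where p: "p \<in> {0..1}" "\<phi> x u = \<sigma> p" using u(1) by (auto simp: H_def path_image_def)
    have "p \<noteq> 0" using p(2) assms(3) inj[of u a] ub \<open>a < b\<close> by (auto simp: pathstart_def)
    moreover have "p \<noteq> 1" using p(2) assms(4) inj[of u b] ub by (auto simp: pathfinish_def)
    ultimately have "\<phi> (\<sigma> p) (- s) \<in> B" using p(1) s by (intro below) auto
    then have "\<phi> x (u - s) \<in> B" using p(2)[symmetric] by (simp add: add)
    then show False using s(3) disj by blast
  qed
  have "\<phi> x ` {b<..} \<subseteq> A \<union> B" using never AB(4) by blast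
  moreover have "\<phi> x (b + \<delta> / 2) \<in> A" by (rule first) (use \<delta>(1) in auto)
  then have "A \<inter> \<phi> x ` {b<..} \<noteq> {}" using \<delta>(1) by auto
  ultimately show ?thesis
    using connectedD[OF connected_orbit[of "{b<..}" x] AB(2,3)] AB(1) by auto
qed

text \<open>Flowing along the interior of the arc \<open>\<sigma>\<close> for short positive and negative times gives two connected
  sets \<open>P\<close> and \<open>N\<close> off \<open>J\<close>. Together with \<open>\<sigma>\<close> they form an open box by invariance of domain, and
  this box meets both sides of \<open>J\<close> because every point of a Jordan curve is a boundary point of both. So
  \<open>P\<close> and \<open>N\<close> lie on different sides. The statement about the past is the one about the future for
  the reversed flow.\<close>
theorem transversal_loop_separates_past_from_future:
  assumes inj: "\<And>s t. \<phi> x s = \<phi> x t \<Longrightarrow> s = t"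
    and \<sigma>: "arc \<sigma>" "pathstart \<sigma> = \<phi> x a" "pathfinish \<sigma> = \<phi> x b" 
    and \<delta>: "\<delta> > 0" "\<And>s t. s \<in> path_image \<sigma> \<Longrightarrow> \<phi> s t \<in> path_image \<sigma> \<Longrightarrow> \<bar>t\<bar> \<le> \<delta> \<Longrightarrow> t = 0"
    and "a < b" and J: "J = \<phi> x ` {a..b} \<union> path_image \<sigma>"
    and free: "\<phi> x ` {a..b} \<inter> path_image \<sigma> \<subseteq> {\<phi> x a, \<phi> x b}"
  obtains A B where "open A" "open B" "A \<inter> B = {}" "A \<union> B = - J" "\<phi> x ` {b<..} \<subseteq> A" "\<phi> x ` {..<a} \<subseteq> B"
proof -
  define c where "c = (\<lambda>t. \<phi> x (a + t * (b - a)))"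
  have c: "arc c"
    unfolding arc_def path_def
  proof
    show "continuous_on {0..1} c" unfolding c_def by (intro continuous_intros)
    show "inj_on c {0..1}"
    proof (rule inj_onI)
      fix s t assume "c s = c t"
      then have "a + s * (b - a) = a + t * (b - a)" unfolding c_def by (rule inj)
      then show "s = t" using \<open>a < b\<close> by simp
    qed
  qed
  have cim: "path_image c = \<phi> x ` {a..b}"
  proof -
    have "(\<lambda>t. (b - a) * t + a) ` {0..1} = {a..b}"
      using \<open>a < b\<close> by (subst image_affinity_atLeastAtMost) auto
    then have "\<phi> x ` (\<lambda>t. (b - a) * t + a) ` {0..1} = \<phi> x ` {a..b}" by simp
    then show ?thesis by (simp add: path_image_def c_def image_image add.commute mult.commute)
  qed
  have cends: "pathstart c = \<phi> x a" "pathfinish c = \<phi> x b"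
    by (auto simp: c_def pathstart_def pathfinish_def)
  define l where "l = c +++ reversepath \<sigma>"
  have l: "simple_path l" "pathfinish l = pathstart l"
    unfolding l_def by (rule simple_path_join_loop) (use c \<sigma> cends free cim in \<open>auto simp: arc_reversepath\<close>)
  have lim: "path_image l = J"
    unfolding l_def by (subst path_image_join) (use \<sigma> cends cim J in auto)
  note Jordan = Jordan_inside_outside[OF l, unfolded lim]

  have emb_eq: "s = t \<and> \<sigma> p = \<sigma> q" if "p \<in> {0..1}" "q \<in> {0..1}" "\<phi> (\<sigma> p) s = \<phi> (\<sigma> q) t" "\<bar>s - t\<bar> \<le> \<delta>" for p q s t
  proof -
    have "\<phi> (\<phi> (\<sigma> p) s) (- t) = \<phi> (\<phi> (\<sigma> q) t) (- t)" using that(3) by simp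
    then have eq: "\<phi> (\<sigma> p) (s - t) = \<sigma> q" by (simp add: add)
    have "s - t = 0" by (rule \<delta>(2)[of "\<sigma> p"]) (use that eq in \<open>auto simp: path_image_def\<close>)
    then show ?thesis using eq by simp
  qed
  define \<eta> where "\<eta> = \<delta> / 2"
  have \<eta>: "\<eta> > 0" using \<delta>(1) by (simp add: \<eta>_def)
  define \<Phi> where "\<Phi> = (\<lambda>(p, s). \<phi> (\<sigma> p) s)"
  have \<Phi>c: "continuous_on ({0<..<1} \<times> A) \<Phi>" for A
  proof -
    have "continuous_on {0<..<1} \<sigma>" using \<sigma>(1) by (auto simp: arc_def path_def intro: continuous_on_subset)
    then have "continuous_on ({0<..<1} \<times> A) (\<lambda>z. \<sigma> (fst z))"
      by (rule continuous_on_compose2) (auto intro!: continuous_intros)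
    then show ?thesis unfolding \<Phi>_def case_prod_unfold by (intro continuous_intros)
  qed
  have "inj_on \<Phi> ({0<..<1} \<times> {-\<eta><..<\<eta>})"
  proof (rule inj_onI)
    fix z w assume z: "z \<in> {0<..<1} \<times> {-\<eta><..<\<eta>}" and w: "w \<in> {0<..<1} \<times> {-\<eta><..<\<eta>}" and eq: "\<Phi> z = \<Phi> w"
    have "snd z = snd w \<and> \<sigma> (fst z) = \<sigma> (fst w)"
      by (rule emb_eq) (use z w eq in \<open>auto simp: \<Phi>_def case_prod_unfold \<eta>_def\<close>)
    moreover have "inj_on \<sigma> {0..1}" using \<sigma>(1) by (simp add: arc_def)
    ultimately show "z = w" using z w by (auto simp: prod_eq_iff dest: inj_onD)
  qed
  then have openE: "open (\<Phi> ` ({0<..<1} \<times> {-\<eta><..<\<eta>}))"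
    by (intro invariance_of_domain_gen \<Phi>c open_Times) auto
  have offJ: "\<phi> (\<sigma> p) s \<notin> J" if p: "0 < p" "p < 1" and s: "s \<noteq> 0" "\<bar>s\<bar> < \<delta>" for p s
  proof
    have \<sigma>p: "\<sigma> p \<in> path_image \<sigma>" using p by (auto simp: path_image_def)
    have ends: "\<sigma> p \<noteq> \<phi> x a" "\<sigma> p \<noteq> \<phi> x b"
      using \<sigma> p inj_onD[of \<sigma> "{0..1}" p 0] inj_onD[of \<sigma> "{0..1}" p 1]
      by (auto simp: arc_def pathstart_def pathfinish_def)
    assume "\<phi> (\<sigma> p) s \<in> J"
    then consider "\<phi> (\<sigma> p) s \<in> path_image \<sigma>" | u where "u \<in> {a..b}" "\<phi> (\<sigma> p) s = \<phi> x u"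
      unfolding J by auto
    then show False
    proof cases
      case 1 then show False using \<delta>(2)[OF \<sigma>p 1] s by auto
    next
      case 2
      have orb: "\<sigma> p = \<phi> x (u - s)"
        using arg_cong[OF 2(2), of "\<lambda>z. \<phi> z (- s)"] by (simp add: add)
      show False
      proof (cases "u - s \<in> {a..b}")
        case True
        then have "\<sigma> p \<in> {\<phi> x a, \<phi> x b}" using free orb \<sigma>p by blast
        then show False using ends by auto
      next
        case False
        then consider "u - s < a" | "u - s > b" using 2(1) by fastforce
        then show False
        proof cases
          case 1
          have "\<phi> (\<sigma> p) (a - (u - s)) = \<phi> x a" unfolding orb by (simp add: add)
          moreover have "\<phi> x a \<in> path_image \<sigma>" using \<sigma>(2) by (metis pathstart_in_path_image)
          ultimately have "a - (u - s) = 0" using 1 2(1) s by (intro \<delta>(2)[OF \<sigma>p]) auto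
          then show False using 1 by simp
        next
          case 2
          have "\<phi> (\<sigma> p) (b - (u - s)) = \<phi> x b" unfolding orb by (simp add: add)
          moreover have "\<phi> x b \<in> path_image \<sigma>" using \<sigma>(3) by (metis pathfinish_in_path_image)
          ultimately have "b - (u - s) = 0" using 2 \<open>u \<in> {a..b}\<close> s by (intro \<delta>(2)[OF \<sigma>p]) auto
          then show False using 2 by simp
        qed
      qed
    qed
  qed
  define P N where "P = \<Phi> ` ({0<..<1} \<times> {0<..<\<eta>})" and "N = \<Phi> ` ({0<..<1} \<times> {-\<eta><..<0})"
  have PN: "connected P" "connected N"
    unfolding P_def N_def by (intro connected_continuous_image \<Phi>c connected_Times; simp)+
  have PNJ: "P \<subseteq> - J" "N \<subseteq> - J"
    using offJ \<delta>(1) by (auto simp: P_def N_def \<Phi>_def \<eta>_def)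
  have box: "\<Phi> ` ({0<..<1} \<times> {-\<eta><..<\<eta>}) \<subseteq> P \<union> N \<union> J"
  proof
    fix z assume "z \<in> \<Phi> ` ({0<..<1} \<times> {-\<eta><..<\<eta>})"
    then obtain p s where ps: "0 < p" "p < 1" "- \<eta> < s" "s < \<eta>" "z = \<Phi> (p, s)" by auto
    consider "s > 0" | "s < 0" | "s = 0" by linarith
    then show "z \<in> P \<union> N \<union> J"
    proof cases
      case 3
      then have "z \<in> path_image \<sigma>" using ps by (auto simp: \<Phi>_def path_image_def)
      then show ?thesis by (simp add: J)
    qed (use ps in \<open>auto simp: P_def N_def\<close>)
  qed
  let ?I = "inside J" and ?O = "outside J"
  have mid: "\<Phi> (1/2, 0) \<in> \<Phi> ` ({0<..<1} \<times> {-\<eta><..<\<eta>})" "\<Phi> (1/2, 0) \<in> J"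
  proof -
    show "\<Phi> (1/2, 0) \<in> \<Phi> ` ({0<..<1} \<times> {-\<eta><..<\<eta>})" by (rule imageI) (use \<eta> in simp)
    have "\<sigma> (1/2) \<in> path_image \<sigma>" by (simp add: path_image_def)
    then show "\<Phi> (1/2, 0) \<in> J" by (simp add: \<Phi>_def J)
  qed
  have meets: "(P \<union> N) \<inter> C \<noteq> {}" if "frontier C = J" "C \<subseteq> - J" for C
  proof -
    have "\<Phi> (1/2, 0) \<in> closure C" using mid(2) that(1) by (auto simp: frontier_def)
    then have "\<Phi> ` ({0<..<1} \<times> {-\<eta><..<\<eta>}) \<inter> C \<noteq> {}"
      using open_Int_closure_eq_empty[OF openE, of C] mid(1) by blast
    then show ?thesis using box that(2) by blast
  qed
  have IO: "open ?I" "open ?O" "?I \<inter> ?O = {}" "?I \<union> ?O = - J"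
    using Jordan by auto
  have side: "C \<subseteq> ?I \<or> C \<subseteq> ?O" if C: "connected C" "C \<subseteq> - J" for C
  proof -
    have "?I \<inter> C = {} \<or> ?O \<inter> C = {}"
      by (rule connectedD[OF C(1) IO(1,2)]) (use IO C(2) in auto)
    then show ?thesis using IO(4) C(2) by blast
  qed
  have "P \<subseteq> ?I \<or> P \<subseteq> ?O" "N \<subseteq> ?I \<or> N \<subseteq> ?O"
    using side PN PNJ by auto
  moreover have "(P \<union> N) \<inter> ?I \<noteq> {}" "(P \<union> N) \<inter> ?O \<noteq> {}"
    using Jordan by (intro meets; blast)+
  ultimately have "P \<subseteq> ?I \<and> N \<subseteq> ?O \<or> P \<subseteq> ?O \<and> N \<subseteq> ?I"
    using Jordan by blast
  then obtain A B where AB: "P \<subseteq> A" "N \<subseteq> B" "open A" "open B" "A \<inter> B = {}" "A \<union> B = - J" 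
      "frontier A = J" "frontier B = J"
    using Jordan by (metis Int_commute Un_commute)
  have cl: "closure A \<subseteq> A \<union> J" "closure B \<subseteq> B \<union> J"
    using AB closure_Un_frontier by blast+
  have \<eta>\<delta>: "t = 0" if "s \<in> path_image \<sigma>" "\<phi> s t \<in> path_image \<sigma>" "\<bar>t\<bar> \<le> \<eta>" for s t
    using \<delta>(2)[OF that(1,2)] that(3) \<delta>(1) by (simp add: \<eta>_def)
  have up: "\<phi> (\<sigma> p) s \<in> A" if "0 < p" "p < 1" "0 < s" "s < \<eta>" for p s
    using AB(1) that by (force simp: P_def \<Phi>_def)
  have down: "\<phi> (\<sigma> p) (- s) \<in> B" if "0 < p" "p < 1" "0 < s" "s < \<eta>" for p s
    using AB(2) that by (force simp: N_def \<Phi>_def)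
  have future: "\<phi> x ` {b<..} \<subseteq> A"
    by (rule leaves_transversal_loop_forever[OF inj arc_imp_path[OF \<sigma>(1)] \<sigma>(2,3) \<eta> \<eta>\<delta> \<open>a < b\<close> J])
       (use AB cl up down in auto)
  have past: "(\<lambda>t. \<phi> x (- t)) ` {- a<..} \<subseteq> B"
  proof (rule plane_flow.leaves_transversal_loop_forever[OF reverse, where \<sigma> = "reversepath \<sigma>" and a = "- b" and \<delta> = \<eta> and J = J and B = A])
    show "J = (\<lambda>t. \<phi> x (- t)) ` {- b..- a} \<union> path_image (reversepath \<sigma>)"
    proof -
      have "{a..b} = uminus ` {- b..- a}" by simp
      then show ?thesis unfolding J by (simp only: image_image path_image_reversepath)
    qed
    show "\<phi> (reversepath \<sigma> p) (- s) \<in> B" if "0 < p" "p < 1" "0 < s" "s < \<eta>" for p s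
      unfolding reversepath_def by (rule down) (use that in auto)
    show "\<phi> (reversepath \<sigma> p) (- (- s)) \<in> A" if "0 < p" "p < 1" "0 < s" "s < \<eta>" for p s
      unfolding reversepath_def minus_minus by (rule up) (use that in auto)
    show "s = t" if "\<phi> x (- s) = \<phi> x (- t)" for s t using inj[OF that] by simp
    show "t = 0" if "s \<in> path_image (reversepath \<sigma>)" "\<phi> s (- t) \<in> path_image (reversepath \<sigma>)" "\<bar>t\<bar> \<le> \<eta>" for s t
      using \<eta>\<delta>[of s "- t"] that by simp
  qed (use \<sigma> AB cl \<eta> \<open>a < b\<close> in \<open>auto simp: arc_imp_path\<close>)
  have "\<phi> x t \<in> B" if "t < a" for t
    using past that by (force intro!: subsetD[OF past] image_eqI[of _ _ "- t"])
  then show ?thesis using that[of A B] AB future by blast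
qed

text \<open>The Poincare--Bendixson argument: past and future of the orbit lie on different sides of a Jordan
  curve disjoint from \<open>K\<close>, but both accumulate on the connected set \<open>K\<close>.\<close>
lemma omega_limit_point_off_continuum_fixed:
  assumes "closed K" "connected K" and off: "\<And>t. \<phi> x t \<notin> K"
    and om: "omega_limit \<phi> x \<inter> K \<noteq> {}" and om': "omega_star_limit \<phi> x \<inter> K \<noteq> {}"
    and y: "y \<in> omega_limit \<phi> x" "y \<notin> K"
  shows "fixed_point \<phi> y"
proof (rule ccontr)
  assume nofix: "\<not> fixed_point \<phi> y"
  note inj = orbit_injective[OF off om]
  have "open (- K)" "y \<in> - K" using assms(1) y(2) by auto
  from transit_time_section[OF nofix this] obtain S r \<delta> \<tau> where S: "S \<subseteq> - K" "r > 0" "\<delta> > 0"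
    and unique: "\<And>s t. s \<in> S \<Longrightarrow> \<phi> s t \<in> S \<Longrightarrow> \<bar>t\<bar> \<le> \<delta> \<Longrightarrow> t = 0"
    and \<tau>: "continuous_on (ball y r) \<tau>" "\<And>z. z \<in> ball y r \<Longrightarrow> \<phi> z (\<tau> z) \<in> S \<and> \<bar>\<tau> z\<bar> < \<delta>"
    by metis
  have yb: "y \<in> ball y r" using S(2) by simp
  obtain t1 where t1: "\<phi> x t1 \<in> ball y r"
    using omega_limit_meets_open[OF y(1) open_ball yb] by metis
  obtain t2 where t2: "t2 > t1 + 3 * \<delta>" "\<phi> x t2 \<in> ball y r"
    using omega_limit_meets_open[OF y(1) open_ball yb] by metis
  define f where "f z = \<phi> z (\<tau> z)" for z
  define a where "a = t1 + \<tau> (\<phi> x t1)"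
  define e where "e = t2 + \<tau> (\<phi> x t2)"
  have ae: "a + \<delta> < e" using \<tau>(2)[OF t1] \<tau>(2)[OF t2(2)] t2(1) by (simp add: a_def e_def abs_less_iff)
  have fS: "f ` ball y r \<subseteq> S" using \<tau>(2) by (auto simp: f_def)
  have ends: "\<phi> x a \<in> f ` ball y r" "\<phi> x e \<in> f ` ball y r"
    using imageI[OF t1, of f] imageI[OF t2(2), of f] by (simp_all add: f_def a_def e_def add)
  have "path_connected (f ` ball y r)"
    unfolding f_def
    by (intro path_connected_continuous_image continuous_intros \<tau> convex_imp_path_connected convex_ball)
  moreover have "\<phi> x a \<noteq> \<phi> x e" using inj[of a e] ae S(3) by auto
  ultimately obtain g where g: "arc g" "path_image g \<subseteq> f ` ball y r" "pathstart g = \<phi> x a" "pathfinish g = \<phi> x e"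
    using ends unfolding path_connected_arcwise by blast
  have gS: "path_image g \<subseteq> S" using g(2) fS by blast

  \<comment> \<open>The arc \<open>g\<close> may meet the orbit piece many times. It is cut off at its first meeting point after the
    initial one.\<close>
  define R where "R = {p \<in> {0..1}. g p \<in> \<phi> x ` {a + \<delta>..e}}"
  have "compact R"
  proof -
    have "closedin (top_of_set {0..1}) ({0..1} \<inter> g -` (\<phi> x ` {a + \<delta>..e}))"
      by (intro continuous_closedin_preimage compact_imp_closed compact_orbit)
         (use g(1) in \<open>auto simp: arc_def path_def\<close>)
    then have "closed ({0..1} \<inter> g -` (\<phi> x ` {a + \<delta>..e}))"
      by (rule closedin_closed_trans) simp
    moreover have "R = {0..1} \<inter> ({0..1} \<inter> g -` (\<phi> x ` {a + \<delta>..e}))" by (auto simp: R_def)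
    ultimately show ?thesis by (metis compact_Icc compact_Int_closed)
  qed
  moreover have "1 \<in> R" using g(4) ae by (auto simp: R_def pathfinish_def)
  ultimately obtain p1 where p1: "p1 \<in> R" "\<And>p. p \<in> R \<Longrightarrow> p1 \<le> p"
    using compact_attains_inf[of R] by blast
  then obtain b where b: "g p1 = \<phi> x b" "a + \<delta> \<le> b" by (auto simp: R_def)
  have "p1 \<noteq> 0" using b g(3) inj[of a b] S(3) by (auto simp: pathstart_def)
  then have p1r: "0 < p1" "p1 \<le> 1" using p1(1) by (auto simp: R_def)
  define \<sigma> where "\<sigma> = subpath 0 p1 g"
  have \<sigma>: "arc \<sigma>" "pathstart \<sigma> = \<phi> x a" "pathfinish \<sigma> = \<phi> x b"
  proof -
    show "arc \<sigma>" unfolding \<sigma>_def by (rule arc_subpath_arc) (use g(1) p1r in auto)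
    show "pathstart \<sigma> = \<phi> x a" "pathfinish \<sigma> = \<phi> x b"
      using g(3) b(1) by (simp_all add: \<sigma>_def subpath_def pathstart_def pathfinish_def)
  qed
  have \<sigma>im: "path_image \<sigma> = g ` {0..p1}" using p1r by (simp add: \<sigma>_def path_image_subpath)
  then have "path_image \<sigma> \<subseteq> path_image g" using p1r by (auto simp: path_image_def)
  then have \<sigma>S: "path_image \<sigma> \<subseteq> S" using gS by blast
  have aS: "\<phi> x a \<in> S" using \<sigma>(2) \<sigma>S by (metis pathstart_in_path_image subsetD)
  have free: "\<phi> x ` {a..b} \<inter> path_image \<sigma> \<subseteq> {\<phi> x a, \<phi> x b}"
  proof
    fix z assume "z \<in> \<phi> x ` {a..b} \<inter> path_image \<sigma>"
    then have "z \<in> \<phi> x ` {a..b}" "z \<in> g ` {0..p1}" "z \<in> S" using \<sigma>im \<sigma>S by blast+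
    then obtain u p where u: "a \<le> u" "u \<le> b" "z = \<phi> x u" "z \<in> S" and p: "0 \<le> p" "p \<le> p1" "z = g p"
      by (meson atLeastAtMost_iff imageE)
    show "z \<in> {\<phi> x a, \<phi> x b}"
    proof (cases "u \<le> a + \<delta>")
      case True
      have "u - a = 0" by (rule unique[OF aS]) (use u True in \<open>auto simp: add\<close>)
      then show ?thesis using u(3) by simp
    next
      case False
      have "b \<le> e"
      proof -
        obtain b' where "b' \<le> e" "g p1 = \<phi> x b'" using p1(1) by (auto simp: R_def)
        then show ?thesis using b(1) inj[of b b'] by auto
      qed
      then have "p \<in> R" using False u p p1r by (auto simp: R_def)
      then have "p = p1" using p1(2) p(2) by force
      then show ?thesis using p(3) b(1) by simp
    qed
  qed
  have "a < b" using b(2) S(3) by linarith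
  define J where "J = \<phi> x ` {a..b} \<union> path_image \<sigma>"
  obtain A B where AB: "open A" "open B" "A \<inter> B = {}" "A \<union> B = - J" "\<phi> x ` {b<..} \<subseteq> A" "\<phi> x ` {..<a} \<subseteq> B"
  proof (rule transversal_loop_separates_past_from_future[OF inj \<sigma> S(3) _ \<open>a < b\<close> J_def free])
    show "t = 0" if "s \<in> path_image \<sigma>" "\<phi> s t \<in> path_image \<sigma>" "\<bar>t\<bar> \<le> \<delta>" for s t
      using unique[of s t] that \<sigma>S by blast
  qed
  have "K \<subseteq> A \<union> B" using AB(4) off \<sigma>S S(1) unfolding J_def by blast
  then have side: "A \<inter> K = {} \<or> B \<inter> K = {}"
    using connectedD[OF \<open>connected K\<close> AB(1,2)] AB(3) by auto
  obtain k where k: "k \<in> omega_limit \<phi> x" "k \<in> K" using om by blast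
  have "k \<notin> B"
  proof
    assume "k \<in> B"
    then obtain t where "t > b" "\<phi> x t \<in> B" by (rule omega_limit_meets_open[OF k(1) AB(2)])
    then show False using AB(3,5) by auto
  qed
  obtain k' where k': "k' \<in> omega_star_limit \<phi> x" "k' \<in> K" using om' by blast
  have "k' \<notin> A"
  proof
    assume "k' \<in> A"
    then obtain t where "t < a" "\<phi> x t \<in> A" by (rule omega_star_limit_meets_open[OF k'(1) AB(1)])
    then show False using AB(3,6) by auto
  qed
  then show False using \<open>k \<notin> B\<close> side k(2) k'(2) \<open>K \<subseteq> A \<union> B\<close> by blast
qed

corollary omega_star_limit_point_off_continuum_fixed:
  assumes "closed K" "connected K" and off: "\<And>t. \<phi> x t \<notin> K"
    and om: "omega_limit \<phi> x \<inter> K \<noteq> {}" and om': "omega_star_limit \<phi> x \<inter> K \<noteq> {}"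
    and y: "y \<in> omega_star_limit \<phi> x" "y \<notin> K"
  shows "fixed_point \<phi> y"
proof -
  have "fixed_point (\<lambda>x t. \<phi> x (- t)) y"
    by (rule plane_flow.omega_limit_point_off_continuum_fixed[OF reverse assms(1,2)])
       (use assms in \<open>auto simp: omega_star_limit_eq[symmetric] omega_limit_reverse[symmetric]\<close>)
  then show ?thesis unfolding fixed_point_def by (metis minus_minus)
qed

end

section \<open>Lines homoclinic to a continuum separate its complement\<close>

text \<open>A line whose two ends both converge to the continuum \<open>K\<close>; they may do so without converging to points
  of \<open>K\<close>.\<close>
locale homoclinic_line =
  fixes K :: "complex set" and \<eta> :: "real \<Rightarrow> complex"
  assumes compact_K: "compact K" and connected_K: "connected K" and K_nonempty: "K \<noteq> {}"
    and continuous_line: "continuous_on UNIV \<eta>" and inj_line: "inj \<eta>"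
    and line_off_K: "\<And>t. \<eta> t \<notin> K"
    and ends: "\<And>A. open A \<Longrightarrow> K \<subseteq> A \<Longrightarrow> \<exists>N. \<forall>t. N \<le> \<bar>t\<bar> \<longrightarrow> \<eta> t \<in> A"
begin

lemma continuous_line_on: "continuous_on T \<eta>"
  using continuous_line continuous_on_subset by blast

lemma compact_piece: "compact (\<eta> ` {a..b})"
  by (intro compact_continuous_image continuous_line_on) simp

lemma locally_line:
  assumes "z \<notin> K" obtains e N where "e > 0" "\<And>t. dist (\<eta> t) z < e \<Longrightarrow> \<bar>t\<bar> \<le> N" "\<And>w. w \<in> K \<Longrightarrow> dist w z \<ge> e"
proof -
  have "open (- K)" "z \<in> - K" using compact_K assms by (auto simp: compact_imp_closed)
  then obtain e where e: "e > 0" "cball z e \<subseteq> - K" using open_contains_cball by blast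
  have "open {w. dist z w > e}" by (intro open_Collect_less continuous_intros)
  moreover have "K \<subseteq> {w. dist z w > e}" using e(2) by force
  ultimately have "\<exists>N. \<forall>t. N \<le> \<bar>t\<bar> \<longrightarrow> \<eta> t \<in> {w. dist z w > e}" by (rule ends)
  then obtain N where N: "\<And>t. N \<le> \<bar>t\<bar> \<Longrightarrow> dist z (\<eta> t) > e" by blast
  show ?thesis
  proof (rule that[of e N])
    show "\<bar>t\<bar> \<le> N" if "dist (\<eta> t) z < e" for t
      using N[of t] that by (force simp: dist_commute)
    show "dist w z \<ge> e" if "w \<in> K" for w using e(2) that by (force simp: dist_commute)
  qed (use e in auto)
qed

lemma closed_K_Un_line: assumes "closed T" shows "closed (K \<union> \<eta> ` T)"
proof -
  have "\<exists>d>0. ball z d \<subseteq> - (K \<union> \<eta> ` T)" if z: "z \<notin> K \<union> \<eta> ` T" for z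
  proof -
    obtain e N where e: "e > 0" "\<And>t. dist (\<eta> t) z < e \<Longrightarrow> \<bar>t\<bar> \<le> N" "\<And>w. w \<in> K \<Longrightarrow> dist w z \<ge> e"
      using locally_line[of z] z by blast
    have "compact ({- N..N} \<inter> T)" using assms by (simp add: compact_Int_closed)
    then have "closed (\<eta> ` ({- N..N} \<inter> T))"
      by (intro compact_imp_closed compact_continuous_image continuous_line_on)
    then have "open (ball z e - \<eta> ` ({- N..N} \<inter> T))" by (intro open_Diff) auto
    moreover have "z \<in> ball z e - \<eta> ` ({- N..N} \<inter> T)" using z e(1) by auto
    ultimately obtain d where d: "d > 0" "ball z d \<subseteq> ball z e - \<eta> ` ({- N..N} \<inter> T)"
      using open_contains_ball by blast
    moreover have "ball z e - \<eta> ` ({- N..N} \<inter> T) \<subseteq> - (K \<union> \<eta> ` T)"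
    proof
      fix w assume w: "w \<in> ball z e - \<eta> ` ({- N..N} \<inter> T)"
      then have we: "dist w z < e" by (simp add: dist_commute)
      have "w \<notin> K" using e(3)[of w] we by force
      moreover have "w \<notin> \<eta> ` T"
      proof
        assume "w \<in> \<eta> ` T"
        then obtain t where t: "t \<in> T" "w = \<eta> t" by blast
        then have "\<bar>t\<bar> \<le> N" using e(2) we by simp
        then show False using w t by (auto simp: abs_le_iff)
      qed
      ultimately show "w \<in> - (K \<union> \<eta> ` T)" by blast
    qed
    ultimately show ?thesis by blast
  qed
  then have "open (- (K \<union> \<eta> ` T))" unfolding open_contains_ball by blast
  then show ?thesis by (simp add: closed_def)
qed

lemma bounded_K_Un_line: "bounded (K \<union> range \<eta>)"
proof -
  obtain R where R: "K \<subseteq> ball 0 R"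
    using compact_K compact_imp_bounded bounded_subset_ballD by blast
  obtain N where N: "\<And>t. N \<le> \<bar>t\<bar> \<Longrightarrow> \<eta> t \<in> ball 0 R" using ends[OF open_ball R] by blast
  have "K \<union> range \<eta> \<subseteq> ball 0 R \<union> \<eta> ` {- N..N}"
  proof -
    have "\<eta> t \<in> ball 0 R \<union> \<eta> ` {- N..N}" for t
    proof (cases "N \<le> \<bar>t\<bar>")
      case False
      then have "t \<in> {- N..N}" by auto
      then show ?thesis by blast
    qed (use N in auto)
    then show ?thesis using R by blast
  qed
  moreover have "bounded (ball 0 R \<union> \<eta> ` {- N..N})"
    using compact_imp_bounded[OF compact_piece] by simp
  ultimately show ?thesis using bounded_subset by blast
qed

lemma compact_K_Un_line: "compact (K \<union> range \<eta>)"
  using bounded_K_Un_line closed_K_Un_line[of UNIV] by (simp add: compact_eq_bounded_closed)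

text \<open>Collapsing \<open>K\<close> to a point turns the line into a circle; this is the resulting map to the unit circle,
  which takes the value 1 at both ends of the line since \<open>arctan\<close> tends to \<open>\<plusminus> \<pi> / 2\<close>.\<close>
definition once_around :: "complex \<Rightarrow> complex" where
  "once_around z = (if z \<in> K then 1 else cis (2 * arctan (inv \<eta> z) + pi))"

lemma once_around_line: "once_around (\<eta> t) = cis (2 * arctan t + pi)"
  using line_off_K inj_line by (simp add: once_around_def)

lemma once_around_ends:
  assumes "e > 0" obtains N where "\<And>t. N \<le> \<bar>t\<bar> \<Longrightarrow> dist (cis (2 * arctan t + pi)) 1 < e"
proof -
  have "((\<lambda>t. cis (2 * arctan t + pi)) \<longlongrightarrow> cis (2 * (pi / 2) + pi)) at_top"
    by (intro tendsto_intros tendsto_arctan_at_top)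
  moreover have "cis (2 * (pi / 2) + pi) = 1" by (simp add: complex_eq_iff)
  ultimately have "((\<lambda>t. cis (2 * arctan t + pi)) \<longlongrightarrow> 1) at_top"
    by (simp only:)
  then have "\<forall>\<^sub>F t in at_top. dist (cis (2 * arctan t + pi)) 1 < e"
    using assms by (rule tendstoD)
  then obtain N1 where N1: "\<And>t. t \<ge> N1 \<Longrightarrow> dist (cis (2 * arctan t + pi)) 1 < e"
    by (auto simp: eventually_at_top_linorder)
  have "((\<lambda>t. cis (2 * arctan t + pi)) \<longlongrightarrow> cis (2 * (- (pi / 2)) + pi)) at_bot"
    by (intro tendsto_intros tendsto_arctan_at_bot)
  moreover have "cis (2 * (- (pi / 2)) + pi) = 1" by (simp add: complex_eq_iff)
  ultimately have "((\<lambda>t. cis (2 * arctan t + pi)) \<longlongrightarrow> 1) at_bot"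
    by (simp only:)
  then have "\<forall>\<^sub>F t in at_bot. dist (cis (2 * arctan t + pi)) 1 < e"
    using assms by (rule tendstoD)
  then obtain N2 where N2: "\<And>t. t \<le> N2 \<Longrightarrow> dist (cis (2 * arctan t + pi)) 1 < e"
    by (auto simp: eventually_at_bot_linorder)
  show ?thesis
    by (rule that[of "max \<bar>N1\<bar> \<bar>N2\<bar>"]) (use N1 N2 in \<open>auto simp: abs_if split: if_splits\<close>)
qed

lemma continuous_once_around: "continuous_on (K \<union> range \<eta>) once_around"
  unfolding continuous_on_iff
proof (intro ballI allI impI)
  fix z and e :: real assume z: "z \<in> K \<union> range \<eta>" and "e > 0"
  show "\<exists>d>0. \<forall>w\<in>K \<union> range \<eta>. dist w z < d \<longrightarrow> dist (once_around w) (once_around z) < e"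
  proof (cases "z \<in> K")
    case True
    obtain N where N: "\<And>t. N \<le> \<bar>t\<bar> \<Longrightarrow> dist (cis (2 * arctan t + pi)) 1 < e"
      using once_around_ends[OF \<open>e > 0\<close>] by blast
    have "open (- \<eta> ` {- N..N})" using compact_imp_closed[OF compact_piece] by (rule open_Compl)
    moreover have "z \<in> - \<eta> ` {- N..N}" using True line_off_K by auto
    ultimately obtain d where d: "d > 0" "ball z d \<subseteq> - \<eta> ` {- N..N}" using open_contains_ball by blast
    have "dist (once_around w) (once_around z) < e" if w: "w \<in> K \<union> range \<eta>" "dist w z < d" for w
    proof (cases "w \<in> K")
      case False
      then obtain t where t: "w = \<eta> t" using w(1) by blast
      have "w \<in> ball z d" using w(2) by (simp add: dist_commute)
      then have "t \<notin> {- N..N}" using d(2) t by blast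
      then have "N \<le> \<bar>t\<bar>" by (auto simp: abs_if)
      then show ?thesis using N t True by (simp add: once_around_line) (simp add: once_around_def)
    qed (use True \<open>e > 0\<close> in \<open>simp add: once_around_def\<close>)
    then show ?thesis using d(1) by blast
  next
    case False
    then obtain d0 N where d0: "d0 > 0" "\<And>t. dist (\<eta> t) z < d0 \<Longrightarrow> \<bar>t\<bar> \<le> N" "\<And>w. w \<in> K \<Longrightarrow> dist w z \<ge> d0"
      using locally_line by blast
    obtain t0 where t0: "z = \<eta> t0" using z False by blast
    have "continuous_on (\<eta> ` {- N..N}) (inv \<eta>)"
      by (rule continuous_on_inv[OF continuous_line_on]) (use inj_line in auto)
    then have "continuous_on (\<eta> ` {- N..N}) (\<lambda>w. cis (2 * arctan (inv \<eta> w) + pi))"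
      by (intro continuous_intros continuous_on_cis)
    moreover have zN: "z \<in> \<eta> ` {- N..N}" using d0(1) d0(2)[of t0] t0 by (auto simp: abs_le_iff)
    ultimately obtain d where d: "d > 0" "\<And>w. w \<in> \<eta> ` {- N..N} \<Longrightarrow> dist w z < d \<Longrightarrow> 
        dist (cis (2 * arctan (inv \<eta> w) + pi)) (cis (2 * arctan (inv \<eta> z) + pi)) < e"
      using \<open>e > 0\<close> unfolding continuous_on_iff by blast
    have "dist (once_around w) (once_around z) < e" if w: "w \<in> K \<union> range \<eta>" "dist w z < min d d0" for w
    proof -
      have "w \<notin> K" using d0(3)[of w] w(2) by auto
      then obtain t where t: "w = \<eta> t" using w(1) by blast
      then have "w \<in> \<eta> ` {- N..N}" using d0(2)[of t] w(2) by (auto simp: abs_le_iff)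
      then show ?thesis using d(2)[of w] w(2) \<open>w \<notin> K\<close> False by (simp add: once_around_def)
    qed
    then show ?thesis using d(1) d0(1) by (intro exI[of _ "min d d0"]) auto
  qed
qed

text \<open>If the complement were connected, \<open>once_around = exp (\<i> * g)\<close> with a continuous real \<open>g\<close>, by
  Borsuk's theorem. This \<open>g\<close> is constant on the connected set \<open>K\<close> and so takes almost the same values far
  out at both ends of the line; but along the line it increases by \<open>2 * \<pi>\<close>.\<close>
theorem separates_plane: "\<not> connected (- (K \<union> range \<eta>))"
proof
  let ?X = "K \<union> range \<eta>"
  assume "connected (- ?X)"
  moreover have "once_around \<in> ?X \<rightarrow> sphere 0 1" by (auto simp: once_around_def)
  ultimately have "\<exists>c. homotopic_with_canon (\<lambda>x. True) ?X (sphere 0 1) once_around (\<lambda>x. c)"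
    using Borsuk_separation_theorem[OF compact_K_Un_line] continuous_once_around by simp
  then have "\<exists>g. continuous_on ?X g \<and> (\<forall>z\<in>?X. once_around z = exp (\<i> * of_real (g z)))"
    unfolding inessential_eq_continuous_logarithm_circle .
  then obtain g :: "complex \<Rightarrow> real" where gX: "continuous_on ?X g"
      and g: "\<And>z. z \<in> ?X \<Longrightarrow> once_around z = exp (\<i> * of_real (g z))"
    by blast
  obtain k where k: "k \<in> K" using K_nonempty by blast
  have gK: "g z = g k" if "z \<in> K" for z
  proof -
    have "\<i> * of_real (g z) = \<i> * of_real (g k)"
    proof (rule constant_log_on_connected[OF connected_K, where w = 1 and f = "\<lambda>z. \<i> * of_real (g z)"])
      show "continuous_on K (\<lambda>z. \<i> * of_real (g z))"
        using continuous_on_subset[OF gX, of K] by (intro continuous_intros) simp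
      fix w assume "w \<in> K"
      then show "exp (\<i> * of_real (g w)) = 1"
        using g[of w] by (simp add: once_around_def)
    qed (use that k in auto)
    then show ?thesis by simp
  qed
  have "openin (top_of_set ?X) (?X \<inter> g -` {g k - 1<..<g k + 1})"
    by (rule continuous_openin_preimage_gen[OF gX]) simp
  then obtain A where A: "open A" "?X \<inter> g -` {g k - 1<..<g k + 1} = ?X \<inter> A"
    unfolding openin_open by blast
  have "K \<subseteq> A" using A(2) gK by force
  then obtain N0 where N0: "\<And>t. N0 \<le> \<bar>t\<bar> \<Longrightarrow> \<eta> t \<in> A" using ends[OF A(1) \<open>K \<subseteq> A\<close>] by blast
  define N where "N = max N0 1"
  have close: "\<bar>g (\<eta> t) - g k\<bar> < 1" if "\<bar>t\<bar> = N" for t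
  proof -
    have "\<eta> t \<in> ?X \<inter> A" using N0[of t] that by (auto simp: N_def)
    then have "g (\<eta> t) \<in> {g k - 1<..<g k + 1}" using A(2) by blast
    then show ?thesis by auto
  qed
  have "\<i> * of_real (g (\<eta> N) - (2 * arctan N + pi)) = \<i> * of_real (g (\<eta> (- N)) - (2 * arctan (- N) + pi))"
  proof (rule constant_log_on_connected[where S = UNIV and w = 1 and f = "\<lambda>t. \<i> * of_real (g (\<eta> t) - (2 * arctan t + pi))"])
    have "continuous_on UNIV (\<lambda>t. g (\<eta> t))"
      by (rule continuous_on_compose2[OF gX continuous_line]) auto
    then show "continuous_on UNIV (\<lambda>t. \<i> * of_real (g (\<eta> t) - (2 * arctan t + pi)))"
      by (intro continuous_intros)
    fix t
    have "exp (\<i> * of_real (g (\<eta> t))) = exp (\<i> * of_real (2 * arctan t + pi))"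
      using g[of "\<eta> t"] by (simp only: once_around_line cis_conv_exp) auto
    then show "exp (\<i> * of_real (g (\<eta> t) - (2 * arctan t + pi))) = 1"
      by (simp only: of_real_diff right_diff_distrib exp_diff) simp
  qed auto
  then have "g (\<eta> N) - g (\<eta> (- N)) = 4 * arctan N"
    by (simp add: arctan_minus del: of_real_diff of_real_add)
  moreover have "\<bar>g (\<eta> N) - g (\<eta> (- N))\<bar> < 2" using close[of N] close[of "- N"] by (auto simp: N_def)
  moreover have "arctan N \<ge> pi / 4" using arctan_monotone'[of 1 N] by (simp add: N_def arctan_one)
  ultimately show False using pi_gt3 by linarith
qed

text \<open>For unbounded \<open>U\<close> the plane is separated by the line together with the continuum \<open>- U\<close>, and the
  complement of their union is \<open>U\<close> without the line. If \<open>U\<close> is bounded, the inversion \<open>\<iota>\<close> at a point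
  \<open>p\<close> of \<open>U\<close> off the line leads back to this situation; \<open>p\<close> itself disappears, which does not affect
  connectedness of an open set.\<close>
theorem separates_component:
  assumes U: "U \<in> components (- K)" and line: "range \<eta> \<subseteq> U"
  shows "\<not> connected (U - range \<eta>)"
proof (cases "bounded U")
  case False
  have oU: "open U" using U compact_K by (meson compact_imp_closed open_Compl open_components)
  have KU: "K \<subseteq> - U" using U in_components_subset by fastforce
  obtain R where R: "K \<subseteq> ball 0 R"
    using compact_K compact_imp_bounded bounded_subset_ballD by blast
  have "connected (- ball (0::complex) R)" by (intro connected_complement_bounded_convex) auto
  moreover have "- ball 0 R \<subseteq> - K" using R by auto
  moreover have "U \<inter> - ball 0 R \<noteq> {}" using False bounded_subset[OF bounded_ball] by blast
  ultimately have "- ball 0 R \<subseteq> U" using components_maximal[OF U] by blast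
  then have "bounded (- U)" using bounded_subset[OF bounded_ball, of "- U" 0 R] by blast
  then have "compact (- U)" using oU by (simp add: compact_eq_bounded_closed closed_Compl)
  moreover have "connected (- U)" by (rule component_complement_connected[OF connected_K U])
  ultimately interpret co: homoclinic_line "- U" \<eta>
    using KU K_nonempty line continuous_line inj_line ends
    by unfold_locales (auto intro!: ends)
  have "- (- U \<union> range \<eta>) = U - range \<eta>" by auto
  then show ?thesis using co.separates_plane by simp
next
  case bU: True
  have oU: "open U" using U compact_K by (meson compact_imp_closed open_Compl open_components)
  have cU: "connected U" using U in_components_connected by blast
  have KU: "K \<subseteq> - U" using U in_components_subset by fastforce
  show ?thesis
  proof
    assume con: "connected (U - range \<eta>)"
    have "open (- (K \<union> range \<eta>))" using compact_imp_closed[OF compact_K_Un_line] by (rule open_Compl)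
    moreover have "U - range \<eta> = U \<inter> - (K \<union> range \<eta>)" using KU by auto
    ultimately have op: "open (U - range \<eta>)" using oU by (metis open_Int)
    \<comment> \<open>A line cannot fill an open set: removing one of its points would disconnect it.\<close>
    have "U - range \<eta> \<noteq> {}"
    proof
      assume "U - range \<eta> = {}"
      then have Ueq: "U = range \<eta>" using line by auto
      have "connected (U - {\<eta> 0})" by (rule connected_open_delete[OF oU cU]) simp
      moreover have "open (- (K \<union> \<eta> ` {..0}))" "open (- (K \<union> \<eta> ` {0..}))"
        by (intro open_Compl closed_K_Un_line; simp)+
      moreover have "U - {\<eta> 0} \<subseteq> - (K \<union> \<eta> ` {..0}) \<union> - (K \<union> \<eta> ` {0..})"
        using KU inj_line by (auto simp: Ueq inj_eq)
      moreover have "- (K \<union> \<eta> ` {..0}) \<inter> - (K \<union> \<eta> ` {0..}) \<inter> (U - {\<eta> 0}) = {}"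
      proof -
        have "\<eta> t \<in> \<eta> ` {..0} \<union> \<eta> ` {0..}" for t by (cases "t \<le> 0") auto
        then show ?thesis unfolding Ueq by blast
      qed
      moreover have "\<eta> 1 \<in> - (K \<union> \<eta> ` {..0}) \<inter> (U - {\<eta> 0})" "\<eta> (- 1) \<in> - (K \<union> \<eta> ` {0..}) \<inter> (U - {\<eta> 0})"
        using line_off_K inj_line by (auto simp: Ueq inj_eq)
      ultimately show False unfolding connected_def by blast
    qed
    then obtain p where p: "p \<in> U" "p \<notin> range \<eta>" by blast
    define \<iota> where "\<iota> z = inverse (z - p)" for z
    define \<kappa> where "\<kappa> w = p + inverse w" for w
    have \<iota>\<kappa>: "\<kappa> (\<iota> z) = z" "\<iota> z \<noteq> 0" if "z \<noteq> p" for z using that by (auto simp: \<iota>_def \<kappa>_def)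
    have \<kappa>\<iota>: "\<iota> (\<kappa> w) = w" "\<kappa> w \<noteq> p" if "w \<noteq> 0" for w using that by (auto simp: \<iota>_def \<kappa>_def)
    have \<iota>c: "continuous_on S \<iota>" if "p \<notin> S" for S unfolding \<iota>_def by (intro continuous_intros) (use that in auto)
    define L where "L = insert 0 (\<iota> ` (- U))"
    have Lcompl: "- L = {w \<in> - {0}. \<kappa> w \<in> U}"
    proof (intro equalityI subsetI)
      fix w assume w: "w \<in> - L"
      then have "w \<noteq> 0" by (auto simp: L_def)
      moreover have "\<kappa> w \<in> U"
      proof (rule ccontr)
        assume "\<kappa> w \<notin> U"
        then have "\<iota> (\<kappa> w) \<in> L" by (simp add: L_def)
        then show False using w \<kappa>\<iota>(1)[OF \<open>w \<noteq> 0\<close>] by simp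
      qed
      ultimately show "w \<in> {w \<in> - {0}. \<kappa> w \<in> U}" by simp
    next
      fix w assume w: "w \<in> {w \<in> - {0}. \<kappa> w \<in> U}"
      have "w \<noteq> \<iota> z" if "z \<notin> U" for z
      proof
        assume "w = \<iota> z"
        moreover have "z \<noteq> p" using that p(1) by auto
        ultimately have "\<kappa> w = z" using \<iota>\<kappa>(1) by simp
        then show False using w that by simp
      qed
      then show "w \<in> - L" using w by (auto simp: L_def)
    qed
    have "closed L"
    proof -
      have "continuous_on (- {0}) \<kappa>" unfolding \<kappa>_def by (intro continuous_intros) auto
      then have "open (- {0} \<inter> \<kappa> -` U)" by (intro continuous_open_preimage oU) auto
      moreover have "- L = - {0} \<inter> \<kappa> -` U" using Lcompl by auto
      ultimately show ?thesis by (simp add: closed_def)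
    qed
    moreover have "bounded L"
    proof -
      obtain e where e: "e > 0" "ball p e \<subseteq> U" using oU p(1) open_contains_ball by blast
      have "norm (\<iota> z) \<le> inverse e" if "z \<notin> U" for z
      proof -
        have "e \<le> norm (z - p)" using e(2) that by (force simp: dist_norm norm_minus_commute)
        then show ?thesis using e(1) by (simp add: \<iota>_def norm_inverse le_imp_inverse_le)
      qed
      then have "bounded (\<iota> ` (- U))" unfolding bounded_iff by blast
      then show ?thesis by (simp add: L_def)
    qed
    ultimately have cL: "compact L" by (simp add: compact_eq_bounded_closed)
    have conL: "connected L"
    proof (rule connected_intermediate_closure)
      show "connected (\<iota> ` (- U))"
        by (intro connected_continuous_image \<iota>c component_complement_connected[OF connected_K U]) (use p in auto)
      have "0 \<in> closure (\<iota> ` (- U))"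
        unfolding closure_approachable
      proof (intro allI impI)
        fix e :: real assume "e > 0"
        have "bounded (ball p (inverse e + 1) \<union> U)" using bU by simp
        then have "ball p (inverse e + 1) \<union> U \<noteq> UNIV" using not_bounded_UNIV by metis
        then obtain z where z: "z \<notin> U" "z \<notin> ball p (inverse e + 1)" by blast
        then have "inverse e < norm (z - p)" by (simp add: dist_norm norm_minus_commute)
        then have "norm (\<iota> z) < e" using \<open>e > 0\<close> 
          by (metis \<iota>_def inverse_inverse_eq inverse_less_imp_less less_imp_inverse_less norm_inverse positive_imp_inverse_positive)
        then show "\<exists>w\<in>\<iota> ` (- U). dist w 0 < e" using z(1) by auto
      qed
      then show "L \<subseteq> closure (\<iota> ` (- U))" 
        using closure_subset[of "\<iota> ` (- U)"] by (simp add: L_def)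
    qed (auto simp: L_def)
    interpret inv: homoclinic_line L "\<iota> \<circ> \<eta>"
    proof
      show "continuous_on UNIV (\<iota> \<circ> \<eta>)"
        by (rule continuous_on_compose[OF continuous_line \<iota>c]) (use p(2) in auto)
      show "inj (\<iota> \<circ> \<eta>)"
        by (rule injI) (metis \<iota>\<kappa>(1) inj_line injD o_apply p(2) rangeI)
      show "(\<iota> \<circ> \<eta>) t \<notin> L" for t
      proof -
        have "\<eta> t \<noteq> p" using p(2) by auto
        then have "\<iota> (\<eta> t) \<in> - L" unfolding Lcompl using \<iota>\<kappa> line by auto
        then show ?thesis by simp
      qed
      show "\<exists>N. \<forall>t. N \<le> \<bar>t\<bar> \<longrightarrow> (\<iota> \<circ> \<eta>) t \<in> A" if A: "open A" "L \<subseteq> A" for A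
      proof -
        have "open (- {p} \<inter> \<iota> -` A)" by (intro continuous_open_preimage \<iota>c A) auto
        moreover have "K \<subseteq> - {p} \<inter> \<iota> -` A" using KU A(2) p(1) by (auto simp: L_def)
        ultimately show ?thesis using ends by fastforce
      qed
    qed (use cL conL in \<open>auto simp: L_def\<close>)
    have "- (L \<union> range (\<iota> \<circ> \<eta>)) = \<iota> ` (U - range \<eta> - {p})"
    proof (intro equalityI subsetI)
      fix w assume w: "w \<in> - (L \<union> range (\<iota> \<circ> \<eta>))"
      then have "w \<noteq> 0" "\<kappa> w \<in> U" using Lcompl by auto
      moreover have "\<kappa> w \<notin> range \<eta>" using w \<kappa>\<iota>(1)[OF \<open>w \<noteq> 0\<close>] by force
      ultimately show "w \<in> \<iota> ` (U - range \<eta> - {p})"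
        using \<kappa>\<iota>[OF \<open>w \<noteq> 0\<close>] by (intro image_eqI[of _ _ "\<kappa> w"]) auto
    next
      fix w assume "w \<in> \<iota> ` (U - range \<eta> - {p})"
      then obtain z where z: "w = \<iota> z" "z \<in> U" "z \<notin> range \<eta>" "z \<noteq> p" by blast
      have "w \<in> - L" unfolding Lcompl using z \<iota>\<kappa> by auto
      moreover have "w \<notin> range (\<iota> \<circ> \<eta>)"
      proof
        assume "w \<in> range (\<iota> \<circ> \<eta>)"
        then obtain t where t: "\<iota> z = \<iota> (\<eta> t)" using z(1) by auto
        have "\<eta> t \<noteq> p" using p(2) by auto
        then have "\<kappa> (\<iota> (\<eta> t)) = \<eta> t" by (rule \<iota>\<kappa>(1))
        then have "z = \<eta> t" using \<iota>\<kappa>(1)[OF z(4)] unfolding t by simp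
        then show False using z(3) by simp
      qed
      ultimately show "w \<in> - (L \<union> range (\<iota> \<circ> \<eta>))" by simp
    qed
    moreover have "connected (\<iota> ` (U - range \<eta> - {p}))"
      by (intro connected_continuous_image \<iota>c connected_open_delete[OF op con]) auto
    ultimately show False using inv.separates_plane by simp
  qed
qed

end

section \<open>Discs filled with homoclinic lines\<close>

text \<open>The bounded region \<open>V\<close> is cut off from \<open>U\<close> by the line through \<open>x\<close>, and all orbits in \<open>V\<close> are lines
  homoclinic to \<open>K\<close>. The line through \<open>x\<close> serves as a reference: it tells the outer side of another
  line from its inner side.\<close>
locale disc_of_homoclinic_lines = plane_flow \<phi> for \<phi> +
  fixes K U V :: "complex set" and x :: complex
  assumes compact_K: "compact K" and U: "U \<in> components (- K)" and xU: "\<And>t. \<phi> x t \<in> U"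
    and V: "V \<in> components (- (K \<union> range (\<phi> x)))" and VU: "V \<subseteq> U" and bounded_V: "bounded V"
    and orbit_V: "\<And>z t. z \<in> V \<Longrightarrow> \<phi> z t \<in> V"
    and lines: "\<And>z. z \<in> V \<Longrightarrow> homoclinic_line K (\<phi> z)"
    and line_x: "homoclinic_line K (\<phi> x)"
begin

abbreviation line :: "complex \<Rightarrow> complex set" where "line z \<equiv> range (\<phi> z)"

definition exterior :: "complex \<Rightarrow> complex set" where
  "exterior z = connected_component_set (U - line z) x"

definition interior_side :: "complex \<Rightarrow> complex set" where
  "interior_side z = U - line z - exterior z"

lemma open_U: "open U"
  using U compact_K by (meson compact_imp_closed open_Compl open_components)

lemma K_U: "K \<inter> U = {}"
  using in_components_subset[OF U] by auto

lemma connected_line: "connected (line z)"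
  by (rule connected_orbit[OF connected_UNIV])

lemma self_in_line: "z \<in> line z"
  by (metis zero rangeI)

lemma line_cong: "w \<in> line z \<Longrightarrow> line w = line z"
proof -
  assume "w \<in> line z"
  then obtain s where s: "w = \<phi> z s" by blast
  have "\<phi> w t \<in> line z" for t by (simp add: s add)
  moreover have "\<phi> z t \<in> line w" for t
  proof -
    have "\<phi> z t = \<phi> w (t - s)" by (simp add: s add)
    then show ?thesis by blast
  qed
  ultimately show ?thesis by blast
qed

lemma lines_disjoint: "w \<notin> line z \<Longrightarrow> line w \<inter> line z = {}"
  using line_cong self_in_line by (metis disjoint_iff)

lemma line_V: "z \<in> V \<Longrightarrow> line z \<subseteq> V"
  using orbit_V by blast

lemma V_off: "V \<inter> K = {}" "V \<inter> line x = {}"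
  using in_components_subset[OF V] by auto

lemma open_V: "open V"
proof -
  interpret homoclinic_line K "\<phi> x" by (rule line_x)
  show ?thesis using V compact_K_Un_line by (meson compact_imp_closed open_Compl open_components)
qed

lemma open_U_minus_line: assumes "z \<in> V" shows "open (U - line z)"
proof -
  interpret l: homoclinic_line K "\<phi> z" by (rule lines[OF assms])
  have "U - line z = U \<inter> - (K \<union> line z)" using K_U by auto
  then show ?thesis using open_U l.compact_K_Un_line by (metis compact_imp_closed open_Compl open_Int)
qed

lemma line_x_in: "z \<in> V \<Longrightarrow> line x \<subseteq> U - line z"
  using xU line_V V_off(2) by blast

lemma x_in: "z \<in> V \<Longrightarrow> x \<in> U - line z"
  using line_x_in self_in_line by blast

lemma exterior_component: "z \<in> V \<Longrightarrow> exterior z \<in> components (U - line z)"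
  unfolding exterior_def by (rule componentsI) (rule x_in)

lemma line_x_exterior: assumes "z \<in> V" shows "line x \<subseteq> exterior z"
  unfolding exterior_def
  by (rule connected_component_maximal[OF self_in_line connected_line line_x_in[OF assms]])

lemma open_exterior: "z \<in> V \<Longrightarrow> open (exterior z)"
  unfolding exterior_def by (intro open_connected_component open_U_minus_line)

lemma interior_side_nonempty: assumes "z \<in> V" shows "interior_side z \<noteq> {}"
proof
  interpret l: homoclinic_line K "\<phi> z" by (rule lines[OF assms])
  have "\<not> connected (U - line z)"
    by (rule l.separates_component[OF U]) (use assms line_V VU in blast)
  moreover assume "interior_side z = {}"
  then have "exterior z = U - line z"
    using in_components_subset[OF exterior_component[OF assms]] by (auto simp: interior_side_def)
  ultimately show False using in_components_connected[OF exterior_component[OF assms]] by simp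
qed

text \<open>Otherwise the component would be open and closed in the connected set \<open>U\<close>.\<close>
lemma component_touches_line:
  assumes z: "z \<in> V" and W: "W \<in> components (U - line z)"
  shows "closure W \<inter> line z \<noteq> {}"
proof
  assume disj: "closure W \<inter> line z = {}"
  have "frontier W \<subseteq> - (U - line z)"
    by (rule frontier_of_components_closed_complement) (use W open_U_minus_line[OF z] in \<open>auto simp: closed_Compl simp del: Compl_Diff_eq\<close>)
  then have "closure W \<subseteq> W \<union> - (U - line z)" using closure_Un_frontier by blast
  then have "closure W \<inter> U \<subseteq> W" using disj by blast
  moreover have WU: "W \<subseteq> U - line z" "W \<noteq> {}" using W by (auto dest: in_components_subset in_components_nonempty)
  ultimately have cl: "W = U \<inter> closure W" using closure_subset by blast
  have "open W" using W open_U_minus_line[OF z] by (rule open_components[rotated])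
  then have "openin (top_of_set U) W" using WU(1) by (intro open_openin_trans open_U) auto
  moreover have "closedin (top_of_set U) W" using cl by (metis closed_closure closedin_closed_Int)
  ultimately have "W = {} \<or> W = U"
    using in_components_connected[OF U] by (auto simp: connected_clopen)
  moreover have "line z \<subseteq> U" using line_V[OF z] VU by blast
  ultimately show False using WU self_in_line[of z] by auto
qed

text \<open>A component on the inner side avoids the line through \<open>x\<close>, and it comes close to the line through
  \<open>z\<close>, which lies in \<open>V\<close>.\<close>
lemma interior_side_subset_V: assumes z: "z \<in> V" shows "interior_side z \<subseteq> V"
proof
  fix q assume q: "q \<in> interior_side z"
  define W where "W = connected_component_set (U - line z) q"
  have qU: "q \<in> U - line z" using q by (auto simp: interior_side_def)
  then have W: "W \<in> components (U - line z)" "q \<in> W" by (auto simp: W_def componentsI)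
  have "W \<noteq> exterior z" using W(2) q by (auto simp: interior_side_def)
  then have "W \<inter> exterior z = {}"
    using components_eq[OF W(1) exterior_component[OF z]] by blast
  then have "W \<subseteq> - (K \<union> line x)"
    using line_x_exterior[OF z] in_components_subset[OF W(1)] K_U by blast
  moreover have "V \<inter> W \<noteq> {}"
    using component_touches_line[OF z W(1)] line_V[OF z] open_Int_closure_eq_empty[OF open_V, of W] by blast
  ultimately have "W \<subseteq> V"
    using components_maximal[OF V in_components_connected[OF W(1)]] by blast
  then show "q \<in> V" using W(2) by blast
qed

lemma closure_interior_side: assumes z: "z \<in> V" shows "closure (interior_side z) \<inter> U \<subseteq> interior_side z \<union> line z"
proof -
  have "exterior z \<inter> closure (interior_side z) = {}"
    using open_Int_closure_eq_empty[OF open_exterior[OF z], of "interior_side z"] by (auto simp: interior_side_def)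
  then show ?thesis by (auto simp: interior_side_def)
qed

lemma line_interior_side:
  assumes z: "z \<in> V" and y: "y \<in> interior_side z" shows "line y \<subseteq> interior_side z"
proof -
  have "y \<in> V" using interior_side_subset_V[OF z] y by blast
  then have sub: "line y \<subseteq> U - line z"
    using line_V VU lines_disjoint[of y z] y by (auto simp: interior_side_def)
  have "line y \<inter> exterior z = {}"
  proof (rule ccontr)
    assume "line y \<inter> exterior z \<noteq> {}"
    then have "line y \<subseteq> exterior z"
      using components_maximal[OF exterior_component[OF z] connected_line sub] by blast
    then show False using y self_in_line[of y] unfolding interior_side_def by blast
  qed
  then show ?thesis using sub by (auto simp: interior_side_def)
qed

text \<open>The outer side of \<open>z\<close> together with its line is connected, contains \<open>x\<close> and avoids the line through
  \<open>y\<close>. Hence it is part of the outer side of \<open>y\<close>.\<close>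
lemma interior_side_mono:
  assumes z: "z \<in> V" and y: "y \<in> interior_side z" shows "interior_side y \<subseteq> interior_side z"
proof -
  have yV: "y \<in> V" using interior_side_subset_V[OF z] y by blast
  obtain w where w: "w \<in> closure (exterior z)" "w \<in> line z"
    using component_touches_line[OF z exterior_component[OF z]] by blast
  have "connected (insert w (exterior z))"
    by (rule connected_intermediate_closure[OF in_components_connected[OF exterior_component[OF z]]])
       (use w closure_subset in auto)
  then have "connected (insert w (exterior z) \<union> line z)"
    by (rule connected_Un[OF _ connected_line]) (use w in blast)
  moreover have "insert w (exterior z) \<union> line z = exterior z \<union> line z" using w by blast
  ultimately have con: "connected (exterior z \<union> line z)" by simp
  have ly: "line y \<subseteq> interior_side z" by (rule line_interior_side[OF z y])
  have "exterior z \<union> line z \<subseteq> U - line y"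
    using ly in_components_subset[OF exterior_component[OF z]] line_V[OF z] VU
    by (auto simp: interior_side_def)
  moreover have "x \<in> exterior z \<union> line z" using line_x_exterior[OF z] self_in_line by blast
  ultimately have "exterior z \<union> line z \<subseteq> exterior y"
    unfolding exterior_def[of y] by (intro connected_component_maximal con)
  then show ?thesis by (auto simp: interior_side_def)
qed

text \<open>Zorn's lemma for points ordered by \<open>y \<in> interior_side z\<close>. If every line in \<open>V\<close> leaves \<open>A\<close>, the
  compact sets \<open>closure (interior_side a) - A\<close> of a chain have a common point \<open>p\<close>, and the line
  through \<open>p\<close> is a bound of the chain.\<close>
theorem arbitrarily_small_line:
  assumes A: "open A" "K \<subseteq> A"
  shows "\<exists>z\<in>V. line z \<subseteq> A"
proof (rule ccontr)
  assume "\<not> ?thesis"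
  then have large: "\<not> line z \<subseteq> A" if "z \<in> V" for z using that by blast
  define P where "P z y \<longleftrightarrow> y = z \<or> y \<in> interior_side z" for z y
  have not_self: "z \<notin> interior_side z" for z using self_in_line by (auto simp: interior_side_def)
  have Psub: "interior_side y \<subseteq> interior_side z" if "z \<in> V" "P z y" for z y
    using that interior_side_mono by (auto simp: P_def)
  have "partial_order_on V (relation_of P V)"
  proof (rule partial_order_on_relation_ofI)
    show "P a a" for a by (simp add: P_def)
    show "P a c" if "a \<in> V" "P a b" "P b c" for a b c
      using that interior_side_mono[of a b] by (auto simp: P_def)
    show "a = b" if "a \<in> V" "P a b" "P b a" for a b
      using that interior_side_mono[of a b] not_self by (auto simp: P_def)
  qed
  moreover have "\<exists>u\<in>V. \<forall>a\<in>C. P a u" if C: "C \<in> Chains (relation_of P V)" for C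
  proof -
    have CV: "C \<subseteq> V" using C by (auto simp: Chains_def relation_of_def)
    have chain: "P a b \<or> P b a" if "a \<in> C" "b \<in> C" for a b
      using C that by (auto simp: Chains_def relation_of_def)
    show ?thesis
    proof (cases "\<exists>u\<in>C. \<forall>a\<in>C. P a u")
      case True
      then show ?thesis using CV by blast
    next
      case False
      \<comment> \<open>A common point \<open>p\<close> of the closures could lie on the lines themselves. In a chain without last element
        this is excluded by passing to a later element.\<close>
      have next_one: "\<exists>b\<in>C. b \<in> interior_side a" if "a \<in> C" for a
        using False that chain by (metis P_def)
      define D where "D a = closure (interior_side a) - A" for a
      have "\<Inter> (D ` C) \<noteq> {}"
      proof (rule compact_chain)
        fix S assume "S \<in> D ` C"
        then obtain a where a: "a \<in> C" "S = D a" by blast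
        have "bounded (interior_side a)"
          using interior_side_subset_V bounded_V CV a(1) bounded_subset by blast
        then have "compact (closure (interior_side a) \<inter> - A)"
          using A(1) by (intro compact_Int_closed) (auto simp: compact_closure)
        then show "compact S" by (simp add: a(2) D_def Diff_eq)
      next
        show "{} \<notin> D ` C"
        proof
          assume "{} \<in> D ` C"
          then obtain a where a: "a \<in> C" "D a = {}" by (metis imageE)
          have aV: "a \<in> V" using a(1) CV by blast
          obtain q where q: "q \<in> interior_side a" using interior_side_nonempty[OF aV] by blast
          then have "q \<in> V" using interior_side_subset_V[OF aV] by blast
          then obtain w where "w \<in> line q" "w \<notin> A" using large by blast
          moreover have "line q \<subseteq> closure (interior_side a)"
            using line_interior_side[OF aV q] closure_subset by blast
          ultimately show False using a(2) by (auto simp: D_def)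
        qed
      next
        fix S T assume "S \<in> D ` C \<and> T \<in> D ` C"
        then obtain a b where ab: "a \<in> C" "b \<in> C" "S = D a" "T = D b" by blast
        then have "interior_side a \<subseteq> interior_side b \<or> interior_side b \<subseteq> interior_side a"
          using chain[of a b] Psub CV by blast
        then show "S \<subseteq> T \<or> T \<subseteq> S" unfolding ab D_def using closure_mono by blast
      qed
      then obtain p where p: "\<And>a. a \<in> C \<Longrightarrow> p \<in> closure (interior_side a) - A"
        unfolding D_def by blast
      have pin: "p \<in> interior_side a" if a: "a \<in> C" for a
      proof -
        have aV: "a \<in> V" using a CV by blast
        obtain b where b: "b \<in> C" "b \<in> interior_side a" using next_one[OF a] by blast
        have bV: "b \<in> V" using b CV by blast
        have pb: "p \<in> closure (interior_side b)" "p \<notin> A" using p[OF b(1)] by auto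
        have "closure (interior_side b) \<subseteq> closure U"
          using interior_side_subset_V[OF bV] VU by (intro closure_mono) blast
        moreover have "closure U \<subseteq> U \<union> K"
          using frontier_of_components_closed_complement[OF compact_imp_closed[OF compact_K] U] closure_Un_frontier by blast
        ultimately have "p \<in> U" using pb A(2) by blast
        then have "p \<in> interior_side b \<union> line b" using closure_interior_side[OF bV] pb by blast
        then show ?thesis
          using interior_side_mono[OF aV b(2)] line_interior_side[OF aV b(2)] by blast
      qed
      show ?thesis
      proof (cases "C = {}")
        case True
        then show ?thesis using in_components_nonempty[OF V] by blast
      next
        case False
        then obtain a where "a \<in> C" by blast
        then have "p \<in> V" using pin interior_side_subset_V CV by blast
        then show ?thesis using pin by (auto simp: P_def)
      qed
    qed
  qed
  ultimately have "\<exists>m\<in>V. \<forall>a\<in>V. P m a \<longrightarrow> a = m" by (rule predicate_Zorn)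
  then obtain m where m: "m \<in> V" "\<And>a. a \<in> V \<Longrightarrow> P m a \<Longrightarrow> a = m" by blast
  obtain q where q: "q \<in> interior_side m" using interior_side_nonempty[OF m(1)] by blast
  then have "q = m" using m interior_side_subset_V[OF m(1)] by (auto simp: P_def)
  then show False using q not_self by blast
qed

end

section \<open>Fixed points in a complementary component\<close>

context plane_flow
begin

lemma omega_limit_subset_closure_component:
  assumes "invariant_set \<phi> G" "closed G" "V \<in> components (- G)" "z \<in> V"
  shows "omega_limit \<phi> z \<subseteq> V \<union> G"
proof -
  have "omega_limit \<phi> z \<subseteq> closure V"
    by (rule omega_limit_subset_closed[where T = 0])
       (use component_of_complement_invariant[OF assms(1,3,4)] closure_subset in auto)
  also have "\<dots> \<subseteq> V \<union> G"
    using frontier_of_components_closed_complement[OF assms(2,3)] closure_Un_frontier by blast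
  finally show ?thesis .
qed

lemma invariant_Un_orbit: "invariant_set \<phi> K \<Longrightarrow> invariant_set \<phi> (K \<union> range (\<phi> x))"
  by (auto simp: invariant_set_def trajectory_def add)

lemma invariant_reverse:
  assumes "invariant_set \<phi> K" shows "invariant_set (\<lambda>x t. \<phi> x (- t)) K"
  using assms by (auto simp: invariant_set_def trajectory_def)

lemma fixed_point_reverse: "fixed_point (\<lambda>x t. \<phi> x (- t)) p \<longleftrightarrow> fixed_point \<phi> p"
  unfolding fixed_point_def by (metis minus_minus)

text \<open>The region \<open>V\<close> is simply connected since its frontier is connected, so the limit set lies on
  \<open>K \<union> range (\<phi> x)\<close>. If it contains a point of the orbit of \<open>x\<close>, it contains the limit set of \<open>x\<close> as
  well.\<close>
lemma orbit_in_bounded_face_limits_on_continuum: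
  assumes "invariant_set \<phi> K" and om: "omega_limit \<phi> x \<inter> K \<noteq> {}"
    and G: "closed (K \<union> range (\<phi> x))" "connected (K \<union> range (\<phi> x))"
    and V: "V \<in> components (- (K \<union> range (\<phi> x)))" "bounded V" "z \<in> V"
    and nofix: "\<And>p. p \<in> V \<Longrightarrow> \<not> fixed_point \<phi> p"
  shows "omega_limit \<phi> z \<inter> K \<noteq> {}"
proof -
  note inv = invariant_Un_orbit[OF assms(1), of x]
  have zV: "\<phi> z t \<in> V" for t by (rule component_of_complement_invariant[OF inv V(1,3)])
  have "open V" using V(1) G(1) by (meson open_Compl open_components)
  have "connected (frontier V)" by (rule connected_frontier_component_complement[OF G(2) V(1)])
  then have "simply_connected V"
    using V(2) in_components_connected[OF V(1)] simply_connected_eq_frontier_properties[OF \<open>open V\<close>] by simp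
  then have "omega_limit \<phi> z \<inter> V = {}"
    using no_recurrence_in_simply_connected[OF \<open>open V\<close> _ nofix, of z] zV by blast
  then have sub: "omega_limit \<phi> z \<subseteq> K \<union> range (\<phi> x)"
    using omega_limit_subset_closure_component[OF inv G(1) V(1,3)] by blast
  have "omega_limit \<phi> z \<inter> closure V \<noteq> {}"
    by (rule omega_limit_meets_compact) (use V(2) zV closure_subset in \<open>auto simp: compact_closure\<close>)
  then obtain y where y: "y \<in> omega_limit \<phi> z" by blast
  show ?thesis
  proof (cases "y \<in> K")
    case False
    then obtain t where "y = \<phi> x t" using sub y by blast
    then have "omega_limit \<phi> y = omega_limit \<phi> x" by (simp add: omega_limit_orbit)
    then show ?thesis using om omega_limit_of_limit[OF y] by blast
  qed (use y in blast)
qed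

lemma homoclinic_orbit_line:
  assumes "compact K" "connected K" and off: "\<And>t. \<phi> x t \<notin> K"
    and om: "omega_limit \<phi> x \<noteq> {}" "omega_limit \<phi> x \<subseteq> K" 
    and om': "omega_star_limit \<phi> x \<noteq> {}" "omega_star_limit \<phi> x \<subseteq> K"
  shows "homoclinic_line K (\<phi> x)"
proof
  show "compact K" "connected K" "K \<noteq> {}" "\<And>t. \<phi> x t \<notin> K" using assms by auto
  show "continuous_on UNIV (\<phi> x)" by (intro continuous_intros)
  show "inj (\<phi> x)" by (rule injI) (rule orbit_injective[OF off], use om in auto)
  show "\<exists>N. \<forall>t. N \<le> \<bar>t\<bar> \<longrightarrow> \<phi> x t \<in> A" if A: "open A" "K \<subseteq> A" for A
  proof -
    obtain T where T: "\<And>t. t \<ge> T \<Longrightarrow> \<phi> x t \<in> A"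
      by (rule eventually_near_omega_limit[OF assms(1) om(2,1) A]) blast
    have "\<exists>T. \<forall>t\<ge>T. \<phi> x (- t) \<in> A"
      by (rule plane_flow.eventually_near_omega_limit[OF reverse assms(1) _ _ A, of x])
         (use om' in \<open>auto simp: omega_star_limit_eq\<close>)
    then obtain T' where T': "\<And>t. t \<ge> T' \<Longrightarrow> \<phi> x (- t) \<in> A" by blast
    show ?thesis
    proof (intro exI allI impI)
      fix t assume t: "max T T' \<le> \<bar>t\<bar>"
      show "\<phi> x t \<in> A"
        using T[of t] T'[of "- t"] t by (cases "t \<ge> 0") auto
    qed
  qed
qed

text \<open>Isolation of \<open>K\<close> enters at the very end: it excludes the orbit in \<open>U\<close> that stays in \<open>N\<close>.\<close>
theorem fixed_point_near_homoclinic_orbit: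
  assumes K: "compact K" "connected K" "invariant_set \<phi> K"
    and N: "K \<subseteq> interior N" "\<And>S. invariant_set \<phi> S \<Longrightarrow> S \<subseteq> N \<Longrightarrow> S \<subseteq> K"
    and U: "U \<in> components (- K)" "x \<in> U"
    and om: "omega_limit \<phi> x \<inter> K \<noteq> {}" "omega_star_limit \<phi> x \<inter> K \<noteq> {}"
  shows "\<exists>p\<in>U. fixed_point \<phi> p"
proof (rule ccontr)
  assume "\<not> ?thesis"
  then have nofix: "\<not> fixed_point \<phi> p" if "p \<in> U" for p using that by blast
  note clK = compact_imp_closed[OF K(1)]
  have UK: "U \<inter> K = {}" using in_components_subset[OF U(1)] by auto
  have orbU: "\<phi> z t \<in> U" if "z \<in> U" for z t
    by (rule component_of_complement_invariant[OF K(3) U(1) that])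
  have orbK: "\<phi> z t \<notin> K" if "z \<in> U" for z t using orbU[OF that] UK by blast
  have line: "homoclinic_line K (\<phi> z)" 
    if z: "z \<in> U" and om: "omega_limit \<phi> z \<inter> K \<noteq> {}" "omega_star_limit \<phi> z \<inter> K \<noteq> {}" for z
  proof (rule homoclinic_orbit_line[OF K(1,2) orbK[OF z]])
    have "omega_limit \<phi> z \<subseteq> U \<union> K"
      by (rule omega_limit_subset_closure_component[OF K(3) clK U(1) z])
    then show "omega_limit \<phi> z \<subseteq> K"
      using omega_limit_point_off_continuum_fixed[OF clK K(2) orbK[OF z] om] nofix by blast
    have "omega_star_limit \<phi> z \<subseteq> U \<union> K"
      unfolding omega_star_limit_eq
      by (rule plane_flow.omega_limit_subset_closure_component[OF reverse invariant_reverse[OF K(3)] clK U(1) z])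
    then show "omega_star_limit \<phi> z \<subseteq> K"
      using omega_star_limit_point_off_continuum_fixed[OF clK K(2) orbK[OF z] om] nofix by blast
  qed (use om in auto)
  interpret x: homoclinic_line K "\<phi> x" by (rule line[OF U(2) om])
  let ?G = "K \<union> range (\<phi> x)"
  have cptG: "compact ?G" by (rule x.compact_K_Un_line)
  have clG: "closed ?G" using cptG by (rule compact_imp_closed)
  have xU: "range (\<phi> x) \<subseteq> U" using orbU[OF U(2)] by blast
  have conG: "connected ?G"
  proof -
    have "omega_limit \<phi> x \<subseteq> closure (range (\<phi> x))"
      by (rule omega_limit_subset_closed[where T = 0]) (use closure_subset[of "range (\<phi> x)"] in auto)
    then have "K \<inter> closure (range (\<phi> x)) \<noteq> {}" using om(1) by blast
    then have "connected (K \<union> closure (range (\<phi> x)))"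
      by (intro connected_Un K(2) connected_imp_connected_closure connected_orbit connected_UNIV)
    moreover have "closure (range (\<phi> x)) \<subseteq> ?G" using clG by (intro closure_minimal) auto
    then have "K \<union> closure (range (\<phi> x)) = ?G" using closure_subset by blast
    ultimately show ?thesis by simp
  qed
  obtain V where V: "V \<in> components (- ?G)" "V \<subseteq> U" "bounded V"
  proof -
    have "\<not> connected (U - range (\<phi> x))" by (rule x.separates_component[OF U(1) xU])
    then obtain a b where ab: "a \<in> U - range (\<phi> x)" "b \<in> U - range (\<phi> x)"
        "\<not> connected_component (U - range (\<phi> x)) a b"
      unfolding connected_iff_connected_component by blast
    let ?C = "connected_component_set (- ?G)"
    have inU: "?C c \<subseteq> U \<and> ?C c \<in> components (- ?G) \<and> c \<in> ?C c" if c: "c \<in> U - range (\<phi> x)" for c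
    proof -
      have cG: "c \<in> - ?G" using c UK by auto
      have "?C c \<subseteq> - K" using connected_component_subset[of "- ?G" c] by auto
      moreover have "U \<inter> ?C c \<noteq> {}" using c cG by auto
      ultimately have "?C c \<subseteq> U" using components_maximal[OF U(1) connected_connected_component] by blast
      then show ?thesis using cG by (auto simp: componentsI)
    qed
    have "?C a \<noteq> ?C b"
    proof
      assume eq: "?C a = ?C b"
      have "?C a \<subseteq> U - range (\<phi> x)" using inU[OF ab(1)] connected_component_subset[of "- ?G" a] by auto
      moreover have "a \<in> ?C a" "b \<in> ?C a" using inU[OF ab(1)] inU[OF ab(2)] eq by auto
      ultimately show False
        using ab(3) connected_connected_component[of "- ?G" a] unfolding connected_component_def by blast
    qed
    then have "bounded (?C a) \<or> bounded (?C b)"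
      using cobounded_unique_unbounded_component[of "- ?G" a b] compact_imp_bounded[OF cptG] by auto
    then show ?thesis using that inU ab by blast
  qed
  have nofixV: "\<not> fixed_point \<phi> p" if "p \<in> V" for p using nofix V(2) that by blast
  interpret d: disc_of_homoclinic_lines \<phi> K U V x
  proof (intro disc_of_homoclinic_lines.intro disc_of_homoclinic_lines_axioms.intro)
    show "plane_flow \<phi>" by unfold_locales
    show "\<phi> z t \<in> V" if "z \<in> V" for z t
      by (rule component_of_complement_invariant[OF invariant_Un_orbit[OF K(3)] V(1) that])
    show "homoclinic_line K (\<phi> z)" if z: "z \<in> V" for z
    proof (rule line)
      show "omega_limit \<phi> z \<inter> K \<noteq> {}"
        by (rule orbit_in_bounded_face_limits_on_continuum[OF K(3) om(1) clG conG V(1,3) z nofixV])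
      have rng: "range (\<lambda>t. \<phi> x (- t)) = range (\<phi> x)"
      proof -
        have "\<phi> x t \<in> range (\<lambda>t. \<phi> x (- t))" for t by (metis minus_minus rangeI)
        then show ?thesis by blast
      qed
      show "omega_star_limit \<phi> z \<inter> K \<noteq> {}"
        unfolding omega_star_limit_eq
        by (rule plane_flow.orbit_in_bounded_face_limits_on_continuum[OF reverse invariant_reverse[OF K(3)], where x = x and V = V])
           (use om(2) clG conG V z nofixV in \<open>auto simp: rng omega_star_limit_eq[symmetric] fixed_point_reverse\<close>)
    qed (use z V(2) in blast)
    show "homoclinic_line K (\<phi> x)" by (rule line[OF U(2) om])
  qed (use K U V orbU in auto)
  obtain z where z: "z \<in> V" "range (\<phi> z) \<subseteq> interior N"
    using d.arbitrarily_small_line[OF open_interior N(1)] by blast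
  have "invariant_set \<phi> (range (\<phi> z))" by (auto simp: invariant_set_def trajectory_def add)
  then have "range (\<phi> z) \<subseteq> K" using z(2) interior_subset by (intro N(2)) auto
  moreover have "z \<in> range (\<phi> z)" by (metis zero rangeI)
  ultimately show False using UK z(1) V(2) by blast
qed

end

section \<open>From the complex plane to the real coordinate plane\<close>

definition complex_of_vec :: "real ^ 2 \<Rightarrow> complex" where
  "complex_of_vec v = Complex (v $ 1) (v $ 2)"

definition vec_of_complex :: "complex \<Rightarrow> real ^ 2" where
  "vec_of_complex z = vector [Re z, Im z]"

lemma vec_of_complex_inverse [simp]:
  "complex_of_vec (vec_of_complex z) = z" "vec_of_complex (complex_of_vec v) = v"
  by (simp_all add: complex_of_vec_def vec_of_complex_def vec_eq_iff forall_2)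

lemma linear_complex_of_vec: "linear complex_of_vec"
  by (rule linearI) (simp_all add: complex_of_vec_def complex_eq_iff)

lemma linear_vec_of_complex: "linear vec_of_complex"
  by (rule linearI) (simp_all add: vec_of_complex_def vec_eq_iff forall_2)

lemma inj_complex_of_vec: "inj complex_of_vec"
  by (metis injI vec_of_complex_inverse(2))

text \<open>Conjugating the flow with the linear isomorphism of the two planes carries over all notions in the
  hypotheses.\<close>
lemma fixed_point_in_component:
  fixes \<phi> :: "real ^ 2 \<Rightarrow> real \<Rightarrow> real ^ 2" and K :: "(real ^ 2) set"
  assumes \<phi>: "is_flow \<phi>" and K: "isolated_invariant_set \<phi> K" "continuum K" and x: "x \<notin> K"
    and om: "omega_limit \<phi> x \<inter> K \<noteq> {}" "omega_star_limit \<phi> x \<inter> K \<noteq> {}"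
  shows "\<exists>p. fixed_point \<phi> p \<and> connected_component (- K) x p"
proof -
  let ?h = complex_of_vec and ?k = vec_of_complex
  have hc: "continuous_on A ?h" for A by (rule linear_continuous_on) (simp add: linear_complex_of_vec linear_conv_bounded_linear[symmetric])
  have kc: "continuous_on A ?k" for A by (rule linear_continuous_on) (simp add: linear_vec_of_complex linear_conv_bounded_linear[symmetric])
  define \<psi> where "\<psi> z t = ?h (\<phi> (?k z) t)" for z t
  have "continuous_on UNIV (\<lambda>p. ?h ((\<lambda>(v, t). \<phi> v t) (?k (fst p), snd p)))"
  proof (rule continuous_on_compose2[OF hc])
    show "continuous_on UNIV (\<lambda>p. (\<lambda>(v, t). \<phi> v t) (?k (fst p), snd p))"
      by (rule continuous_on_compose2[of UNIV "\<lambda>(v, t). \<phi> v t"])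
         (use \<phi> in \<open>auto simp: is_flow_def intro!: continuous_intros continuous_on_compose2[OF kc]\<close>)
  qed auto
  then have "is_flow \<psi>" using \<phi> by (simp add: is_flow_def \<psi>_def case_prod_unfold)
  then interpret plane_flow \<psi> by unfold_locales
  have img: "\<psi> (?h v) ` T = ?h ` (\<phi> v ` T)" for v T by (auto simp: \<psi>_def image_image)
  have clos: "closure (?h ` S) = ?h ` closure S" for S
    by (rule closure_injective_linear_image[OF linear_complex_of_vec inj_complex_of_vec, symmetric])
  have lim: "omega_limit \<psi> (?h v) = ?h ` omega_limit \<phi> v" "omega_star_limit \<psi> (?h v) = ?h ` omega_star_limit \<phi> v" for v
  proof -
    have *: "(\<Inter>t\<in>A. closure (\<psi> (?h v) ` B t)) = ?h ` (\<Inter>t\<in>A. closure (\<phi> v ` B t))" if "j \<in> A"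
      for A :: "real set" and B and j
      unfolding img clos using inj_complex_of_vec that by (intro image_INT[symmetric, of _ UNIV]) auto
    show "omega_limit \<psi> (?h v) = ?h ` omega_limit \<phi> v"
      unfolding omega_limit_def by (rule *[of 1]) simp
    show "omega_star_limit \<psi> (?h v) = ?h ` omega_star_limit \<phi> v"
      unfolding omega_star_limit_def by (rule *[of "- 1"]) simp
  qed
  have invar: "invariant_set \<psi> (?h ` S) \<longleftrightarrow> invariant_set \<phi> S" for S
    using inj_complex_of_vec by (auto simp: invariant_set_def trajectory_def img inj_image_subset_iff)
  obtain N where N: "compact N" "K \<subseteq> interior N" "\<And>S. invariant_set \<phi> S \<Longrightarrow> S \<subseteq> N \<Longrightarrow> S \<subseteq> K"
  proof -
    obtain N where "isolating_neighborhood \<phi> K N" using K(1) by (auto simp: isolated_invariant_set_def)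
    then show ?thesis using that[of N] by (simp add: isolating_neighborhood_def)
  qed
  have hN: "?h ` K \<subseteq> interior (?h ` N)"
  proof -
    have "?h ` interior N = ?k -` interior N" by (auto simp: image_iff) (metis vec_of_complex_inverse(1))
    moreover have "open (?k -` interior N)" using kc[of UNIV] by (intro open_vimage) auto
    ultimately have "?h ` interior N \<subseteq> interior (?h ` N)"
      by (intro interior_maximal image_mono interior_subset) simp
    then show ?thesis using N(2) by blast
  qed
  have hiso: "S \<subseteq> ?h ` K" if S: "invariant_set \<psi> S" "S \<subseteq> ?h ` N" for S
  proof -
    have "S = ?h ` (?k ` S)" by (simp add: image_image)
    moreover have "?k ` S \<subseteq> K"
    proof (rule N(3))
      show "invariant_set \<phi> (?k ` S)" using S(1) invar[of "?k ` S"] by (simp add: image_image)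
      show "?k ` S \<subseteq> N" using S(2) by auto
    qed
    ultimately show ?thesis by blast
  qed
  let ?U = "connected_component_set (- ?h ` K) (?h x)"
  have hx: "?h x \<in> - ?h ` K" using x inj_complex_of_vec by (simp add: inj_image_mem_iff)
  have "\<exists>p\<in>?U. fixed_point \<psi> p"
  proof (rule fixed_point_near_homoclinic_orbit[where K = "?h ` K" and N = "?h ` N"])
    show "compact (?h ` K)" "connected (?h ` K)"
      using K(2) by (auto simp: continuum_def intro!: compact_continuous_image connected_continuous_image hc)
    show "invariant_set \<psi> (?h ` K)" using K(1) by (simp add: invar isolated_invariant_set_def)
    show "?U \<in> components (- ?h ` K)" "?h x \<in> ?U" using hx by (auto simp: componentsI)
    show "omega_limit \<psi> (?h x) \<inter> ?h ` K \<noteq> {}" "omega_star_limit \<psi> (?h x) \<inter> ?h ` K \<noteq> {}"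
      using om unfolding lim by auto
  qed (fact hN hiso)+
  then obtain p where p: "connected_component (- ?h ` K) (?h x) p" "fixed_point \<psi> p" by auto
  obtain T where T: "connected T" "T \<subseteq> - ?h ` K" "?h x \<in> T" "p \<in> T"
    using p(1) unfolding connected_component_def by blast
  have "connected (?k ` T)" by (intro connected_continuous_image kc T)
  moreover have "?k ` T \<subseteq> - K"
  proof
    fix v assume "v \<in> ?k ` T"
    then obtain z where z: "z \<in> T" "v = ?k z" by blast
    then have "?h v \<notin> ?h ` K" using T(2) by auto
    then show "v \<in> - K" by blast
  qed
  moreover have "x \<in> ?k ` T" "?k p \<in> ?k ` T" using T(3,4) by (metis imageI vec_of_complex_inverse(2))+
  ultimately have "connected_component (- K) x (?k p)" unfolding connected_component_def by blast
  moreover have "fixed_point \<phi> (?k p)"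
    using p(2) unfolding fixed_point_def \<psi>_def by (metis vec_of_complex_inverse(2))
  ultimately show ?thesis by blast
qed

theorem lemma33:
  fixes \<phi> :: "real ^ 2 \<Rightarrow> real \<Rightarrow> real ^ 2" and K :: "(real ^ 2) set"
  assumes "is_flow \<phi>"
    and "isolated_invariant_set \<phi> K"
    and "continuum K"
  shows "(homoclinic_set \<phi> K - K \<noteq> {} \<longrightarrow> (\<exists>p \<in> UNIV - K. fixed_point \<phi> p)) \<and>
         (\<forall>U \<in> components (UNIV - K).
            (\<exists>x. trajectory \<phi> x \<subseteq> U \<and>
                 omega_limit \<phi> x \<inter> K \<noteq> {} \<and> omega_star_limit \<phi> x \<inter> K \<noteq> {}) \<longrightarrow>
            (\<exists>p \<in> U. fixed_point \<phi> p))"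
proof (intro conjI impI ballI)
  assume "homoclinic_set \<phi> K - K \<noteq> {}"
  then obtain x where "x \<in> homoclinic_set \<phi> K" "x \<notin> K" by blast
  then have "x \<notin> K" "omega_limit \<phi> x \<inter> K \<noteq> {}" "omega_star_limit \<phi> x \<inter> K \<noteq> {}"
    by (auto simp: homoclinic_set_def attraction_set_def repulsion_set_def)
  from fixed_point_in_component[OF assms this] obtain p where "fixed_point \<phi> p" "connected_component (- K) x p"
    by blast
  then show "\<exists>p \<in> UNIV - K. fixed_point \<phi> p" using connected_component_in by fastforce
next
  fix U assume U: "U \<in> components (UNIV - K)"
  assume "\<exists>x. trajectory \<phi> x \<subseteq> U \<and> omega_limit \<phi> x \<inter> K \<noteq> {} \<and> omega_star_limit \<phi> x \<inter> K \<noteq> {}"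
  then obtain x where x: "trajectory \<phi> x \<subseteq> U" "omega_limit \<phi> x \<inter> K \<noteq> {}" "omega_star_limit \<phi> x \<inter> K \<noteq> {}"
    by blast
  have "\<phi> x 0 = x" using assms(1) by (simp add: is_flow_def)
  then have xU: "x \<in> U" using x(1) by (metis rangeI subsetD trajectory_def)
  then have "x \<notin> K" using in_components_subset[OF U] by blast
  from fixed_point_in_component[OF assms this x(2,3)] obtain p where p: "fixed_point \<phi> p" "connected_component (- K) x p"
    by blast
  have "U = connected_component_set (- K) x"
    using U xU by (metis Compl_eq_Diff_UNIV components_iff connected_component_eq)
  then show "\<exists>p \<in> U. fixed_point \<phi> p" using p by blast
qed

end
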